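(* Let $T \in \mathbb{F}^{n_1} \otimes \mathbb{F}^{n_2} \otimes \mathbb{F}^{n_3}$. Then \[ \limsup_{m\to\infty} \mathrm{SR}(T^{\boxtimes m})^{1/m} \geq \lim_{m\to\infty} Q(T^{\boxtimes m})^{1/m} \geq \Big(\limsup_{m\to\infty} \mathrm{SR}(T^{\boxtimes m})^{1/m}\Big)^{2/3}. \]
   Context: $\mathbb{F}$ is any field. The subrank $Q(T)$ is the largest $r$ such that there are linear maps $L_i$ with $(L_1\otimes L_2\otimes L_3)T=\sum_{i=1}^r e_i\otimes e_i\otimes e_i$. A tensor has slice rank one if one of its three flattenings (grouping two legs) has rank one, and the slice rank $\mathrm{SR}(T)$ is the smallest number of slice-rank-one tensors summing to $T$. $\boxtimes$ is the Kronecker product. *)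

theory Defs
  imports
    "HOL-Library.Extended_Real"
    "Jordan_Normal_Form.DL_Rank"
begin

text \<open>Elements of \<open>F^n1 \<otimes> F^n2 \<otimes> F^n3\<close> are coordinate arrays in the standard basis, extended by zero
  outside the index box, so that equality of tensors is equality of functions.\<close>

type_synonym 'a tensor3 = "nat \<Rightarrow> nat \<Rightarrow> nat \<Rightarrow> 'a"

definition tensor_space :: "nat \<Rightarrow> nat \<Rightarrow> nat \<Rightarrow> ('a::zero) tensor3 set" where
  "tensor_space n1 n2 n3 =
     {T. \<forall>i j k. \<not> (i < n1 \<and> j < n2 \<and> k < n3) \<longrightarrow> T i j k = 0}"

definition unit_tensor :: "nat \<Rightarrow> ('a::zero_neq_one) tensor3" where
  "unit_tensor r = (\<lambda>i j k. if i < r \<and> i = j \<and> j = k then 1 else 0)"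

text \<open>\<open>(L1 \<otimes> L2 \<otimes> L3) T\<close>, where linear maps are given by their matrices in the standard bases.\<close>

definition tensor_map :: "('a::comm_ring_1) mat \<Rightarrow> 'a mat \<Rightarrow> 'a mat \<Rightarrow> 'a tensor3 \<Rightarrow> 'a tensor3" where
  "tensor_map L1 L2 L3 T = (\<lambda>a b c.
     if a < dim_row L1 \<and> b < dim_row L2 \<and> c < dim_row L3 then
       (\<Sum>i<dim_col L1. \<Sum>j<dim_col L2. \<Sum>k<dim_col L3.
          L1 $$ (a, i) * L2 $$ (b, j) * L3 $$ (c, k) * T i j k)
     else 0)"

text \<open>The set of admissible \<open>r\<close> contains \<open>0\<close> and is bounded by \<open>n1\<close>, so \<open>GREATEST\<close> is its maximum.\<close>

definition subrank :: "nat \<Rightarrow> nat \<Rightarrow> nat \<Rightarrow> ('a::field) tensor3 \<Rightarrow> nat" where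
  "subrank n1 n2 n3 T = (GREATEST r. \<exists>L1 L2 L3.
     L1 \<in> carrier_mat r n1 \<and> L2 \<in> carrier_mat r n2 \<and> L3 \<in> carrier_mat r n3 \<and>
     tensor_map L1 L2 L3 T = unit_tensor r)"

text \<open>In each flattening the grouped pair of legs is indexed by \<open>p * n + q\<close>, with \<open>n\<close> the dimension
  of the second leg of the pair.\<close>

definition flattening1 :: "nat \<Rightarrow> nat \<Rightarrow> nat \<Rightarrow> 'a tensor3 \<Rightarrow> 'a mat" where
  "flattening1 n1 n2 n3 T = mat n1 (n2 * n3) (\<lambda>(i, c). T i (c div n3) (c mod n3))"

definition flattening2 :: "nat \<Rightarrow> nat \<Rightarrow> nat \<Rightarrow> 'a tensor3 \<Rightarrow> 'a mat" where
  "flattening2 n1 n2 n3 T = mat n2 (n1 * n3) (\<lambda>(j, c). T (c div n3) j (c mod n3))"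

definition flattening3 :: "nat \<Rightarrow> nat \<Rightarrow> nat \<Rightarrow> 'a tensor3 \<Rightarrow> 'a mat" where
  "flattening3 n1 n2 n3 T = mat n3 (n1 * n2) (\<lambda>(k, c). T (c div n2) (c mod n2) k)"

definition slice_rank_one :: "nat \<Rightarrow> nat \<Rightarrow> nat \<Rightarrow> ('a::field) tensor3 \<Rightarrow> bool" where
  "slice_rank_one n1 n2 n3 S \<longleftrightarrow>
     vec_space.rank n1 (flattening1 n1 n2 n3 S) = 1 \<or>
     vec_space.rank n2 (flattening2 n1 n2 n3 S) = 1 \<or>
     vec_space.rank n3 (flattening3 n1 n2 n3 S) = 1"

text \<open>Cutting along the first leg writes every tensor as a sum of at most \<open>n1\<close> tensors of slice rank
  one, so \<open>LEAST\<close> ranges over a nonempty set.\<close>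

definition slice_rank :: "nat \<Rightarrow> nat \<Rightarrow> nat \<Rightarrow> ('a::field) tensor3 \<Rightarrow> nat" where
  "slice_rank n1 n2 n3 T = (LEAST r. \<exists>S :: nat \<Rightarrow> 'a tensor3.
     (\<forall>l<r. S l \<in> tensor_space n1 n2 n3 \<and> slice_rank_one n1 n2 n3 (S l)) \<and>
     T = (\<lambda>i j k. \<Sum>l<r. S l i j k))"

text \<open>Kronecker product of \<open>S\<close> with a tensor \<open>T\<close> of format \<open>(n1, n2, n3)\<close>: in each leg the index pair
  \<open>(i, i')\<close> is encoded as \<open>i * n + i'\<close>. Only the format of the right factor enters the encoding.\<close>

definition kronecker :: "nat \<Rightarrow> nat \<Rightarrow> nat \<Rightarrow> ('a::times) tensor3 \<Rightarrow> 'a tensor3 \<Rightarrow> 'a tensor3" where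
  "kronecker n1 n2 n3 S T = (\<lambda>i j k.
     S (i div n1) (j div n2) (k div n3) * T (i mod n1) (j mod n2) (k mod n3))"

text \<open>The \<open>m\<close>-th Kronecker power has format \<open>(n1 ^ m, n2 ^ m, n3 ^ m)\<close>.\<close>

primrec kronecker_power :: "nat \<Rightarrow> nat \<Rightarrow> nat \<Rightarrow> ('a::field) tensor3 \<Rightarrow> nat \<Rightarrow> 'a tensor3" where
  "kronecker_power n1 n2 n3 T 0 = unit_tensor 1"
| "kronecker_power n1 n2 n3 T (Suc m) = kronecker n1 n2 n3 (kronecker_power n1 n2 n3 T m) T"

end

theory Submission
  imports Defs "HOL-Real_Asymp.Real_Asymp"
begin

text \<open>The limit exists because the subrank is supermultiplicative, and it is bounded by the slice
  rank because the unit tensor of size \<open>r\<close> has slice rank \<open>r\<close>. For the lower bound, let \<open>q\<^sub>i\<close> be the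
  maximal rank of a matrix in the span of the slices of \<open>T\<close> along leg \<open>i\<close>. A space of matrices of rank
  at most \<open>q\<^sub>i\<close> is covered by \<open>4 q\<^sub>i\<close> common row and column vectors, so the slice rank of \<open>T\<close> is at most
  \<open>4 q\<close> with \<open>q = min q\<^sub>i\<close>. Contracting one leg in each of three copies of \<open>T\<close> shows that the third power
  of \<open>T\<close> restricts to the matrix multiplication tensor \<open>\<langle>q, q, q\<rangle>\<close>, whose asymptotic subrank is at
  least \<open>q\<^sup>2 / 2\<close> by Strassen's degeneration. Applied to the powers of \<open>T\<close>, the constants disappear.\<close>

section \<open>Spaces of bilinear forms of bounded rank\<close>

text \<open>The exponent 2/3 is an exchange rate: three copies of \<open>T\<close> pay for about
  \<open>q ^ 2\<close> diagonal entries, while the slice rank is only linear in \<open>q\<close>.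
  With \<kappa> the asymptotic subrank this reads \<open>q ^ 2 \<le> 2 * \<kappa> ^ 3\<close>, so
  the square of the slice rank is at most \<open>32 * \<kappa> ^ 3\<close>.

  The obstacle is that the field may be finite. Over a large field, the minors of
  \<open>A + t * M\<close> as polynomials in \<open>t\<close> show that \<open>M\<close> vanishes
  between the kernels of a form \<open>A\<close> of maximal rank, and \<open>2 * q\<close> vectors
  suffice. A small field has too few values of \<open>t\<close>. Comparing just \<open>M\<close> and
  \<open>A + M\<close> still bounds the rank between the kernels by half the maximum; repeating this
  there gives a geometric series, whence the constant 4. Any constant that does not depend on the
  tensor would serve.

  The degeneration is insensitive to the field as well: it selects basis vectors of a power so that
  weights force all nonzero entries onto the diagonal, with no interpolation in a parameter.\<close>

lemma underdetermined_system:
  fixes P :: "'i \<Rightarrow> 'l \<Rightarrow> 'a::field"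
  assumes "finite L" "finite A" "card L < card A"
  shows "\<exists>c. (\<exists>i\<in>A. c i \<noteq> 0) \<and> (\<forall>l\<in>L. (\<Sum>i\<in>A. c i * P i l) = 0)"
  using assms
proof (induction L arbitrary: A P rule: finite_induct)
  case empty
  then obtain i where "i \<in> A" by fastforce
  then show ?case by (intro exI[of _ "\<lambda>_. 1"]) auto
next
  case (insert l L)
  show ?case
  proof (cases "\<forall>i\<in>A. P i l = 0")
    case True
    have "card L < card A" using insert by simp
    from insert.IH[OF insert.prems(1) this] obtain c
      where "\<exists>i\<in>A. c i \<noteq> 0" "\<forall>l\<in>L. (\<Sum>i\<in>A. c i * P i l) = 0" by blast
    then show ?thesis using True by (intro exI[of _ c]) auto
  next
    case False
    then obtain p where p: "p \<in> A" "P p l \<noteq> 0" by blast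
    let ?A = "A - {p}"
    have fin: "finite ?A" using insert.prems by simp
    have "card L < card ?A" using insert p by simp
    \<comment> \<open>Gaussian elimination: equation \<open>l\<close> is solved for the unknown
      \<open>p\<close> and substituted into the others; \<open>c'\<close> below restores the value
      at \<open>p\<close>.\<close>
    from insert.IH[OF fin this, of "\<lambda>i k. P i k - P i l / P p l * P p k"]
    obtain c where c: "\<exists>i\<in>?A. c i \<noteq> 0"
      "\<forall>k\<in>L. (\<Sum>i\<in>?A. c i * (P i k - P i l / P p l * P p k)) = 0" by blast
    define c' where "c' = c(p := - (\<Sum>i\<in>?A. c i * P i l) / P p l)"
    have split: "(\<Sum>i\<in>A. c' i * P i k) = c' p * P p k + (\<Sum>i\<in>?A. c i * P i k)" for k
      using insert.prems(1) p(1) by (subst sum.remove[of A p]) (auto simp: c'_def intro!: sum.cong)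
    have "(\<Sum>i\<in>A. c' i * P i l) = 0"
      unfolding split using p by (simp add: c'_def)
    moreover have "(\<Sum>i\<in>A. c' i * P i k) = 0" if "k \<in> L" for k
    proof -
      define S where "S = (\<Sum>i\<in>?A. c i * P i l)"
      have "0 = (\<Sum>i\<in>?A. c i * P i k - c i * P i l * (P p k / P p l))"
        using c(2) that by (simp add: algebra_simps)
      also have "\<dots> = (\<Sum>i\<in>?A. c i * P i k) - S * (P p k / P p l)"
        by (simp only: S_def sum_subtractf sum_distrib_right)
      finally have "(\<Sum>i\<in>?A. c i * P i k) = S * (P p k / P p l)" by simp
      then show ?thesis unfolding split by (simp add: c'_def S_def[symmetric])
    qed
    moreover have "\<exists>i\<in>A. c' i \<noteq> 0" using c(1) by (auto simp: c'_def)
    ultimately show ?thesis by (intro exI[of _ c']) auto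
  qed
qed

text \<open>A combination of rows that annihilates \<open>P\<close> would annihilate the diagonal
  too, and one exists as soon as \<open>L\<close> is smaller than \<open>A\<close>. This takes the
  place of matrix rank in all dimension counts for forms, for the subrank and for the slice rank of
  the unit tensor.\<close>

lemma diagonal_factor_card_le:
  fixes P :: "'i \<Rightarrow> 'l \<Rightarrow> 'a::field"
  assumes "finite L" "finite A"
    and d: "\<And>a. a \<in> A \<Longrightarrow> d a \<noteq> 0"
    and PQ: "\<And>a b. a \<in> A \<Longrightarrow> b \<in> A \<Longrightarrow> (\<Sum>l\<in>L. P a l * Q l b) = (if a = b then d a else 0)"
  shows "card A \<le> card L"
proof (rule ccontr)
  assume "\<not> ?thesis"
  then have "card L < card A" by simp
  from underdetermined_system[OF assms(1,2) this, of P] obtain c p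
    where p: "p \<in> A" "c p \<noteq> 0" and c: "\<And>l. l \<in> L \<Longrightarrow> (\<Sum>i\<in>A. c i * P i l) = 0" by blast
  have "0 = (\<Sum>l\<in>L. (\<Sum>i\<in>A. c i * P i l) * Q l p)" using c by simp
  also have "\<dots> = (\<Sum>i\<in>A. c i * (\<Sum>l\<in>L. P i l * Q l p))"
    by (simp add: sum_distrib_left sum_distrib_right mult.assoc) (rule sum.swap)
  also have "\<dots> = (\<Sum>i\<in>A. if i = p then c p * d p else 0)"
    using p by (intro sum.cong) (auto simp: PQ)
  also have "\<dots> = c p * d p" using p assms(2) by simp
  finally show False using p d by simp
qed

section \<open>Bilinear forms, with rank measured by dual systems\<close>

type_synonym 'a form = "(nat \<Rightarrow> 'a) \<Rightarrow> (nat \<Rightarrow> 'a) \<Rightarrow> 'a"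

text \<open>Forms live on all sequences rather than on coordinate spaces, so composing a form with
  projections onto kernels gives a form of the same type.\<close>

definition bilinear_form :: "('a::field) form \<Rightarrow> bool" where
  "bilinear_form B \<longleftrightarrow>
     (\<forall>x x' y c. B (\<lambda>i. x i + c * x' i) y = B x y + c * B x' y) \<and>
     (\<forall>x y y' c. B x (\<lambda>i. y i + c * y' i) = B x y + c * B x y')"

lemma bilinear_form_left:
  "bilinear_form B \<Longrightarrow> B (\<lambda>i. x i + c * x' i) y = B x y + c * B x' y"
  and bilinear_form_right:
  "bilinear_form B \<Longrightarrow> B x (\<lambda>i. y i + c * y' i) = B x y + c * B x y'"
  by (auto simp: bilinear_form_def)

lemma bilinear_form_diff_sum_left:
  fixes n :: nat
  assumes "bilinear_form B"
  shows "B (\<lambda>i. x i - (\<Sum>l<n. c l * X l i)) y = B x y - (\<Sum>l<n. c l * B (X l) y)"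
proof (induction n)
  case (Suc n)
  have "B (\<lambda>i. x i - (\<Sum>l<Suc n. c l * X l i)) y
      = B (\<lambda>i. (x i - (\<Sum>l<n. c l * X l i)) + (- c n) * X n i) y"
    by (simp add: algebra_simps)
  also have "\<dots> = B (\<lambda>i. x i - (\<Sum>l<n. c l * X l i)) y + (- c n) * B (X n) y"
    by (rule bilinear_form_left[OF assms])
  finally show ?case by (simp add: Suc)
qed simp

lemma bilinear_form_diff_sum_right:
  fixes n :: nat
  assumes "bilinear_form B"
  shows "B x (\<lambda>i. y i - (\<Sum>l<n. c l * Y l i)) = B x y - (\<Sum>l<n. c l * B x (Y l))"
  using bilinear_form_diff_sum_left[where B = "\<lambda>x y. B y x" and x = y and X = Y and y = x] assms
  by (simp add: bilinear_form_def)

lemma bilinear_form_scale_left: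
  assumes "bilinear_form B"
  shows "B (\<lambda>i. c * x i) y = c * B x y"
proof -
  have 0: "B (\<lambda>i. 0) y = 0"
    using bilinear_form_left[OF assms, of "\<lambda>i. 0" "-1" "\<lambda>i. 0" y] by simp
  show ?thesis using bilinear_form_left[OF assms, of "\<lambda>i. 0" c x y] by (simp add: 0)
qed

text \<open>A dual system of size \<open>t\<close> witnesses that the rank of \<open>B\<close> is at least \<open>t\<close>.\<close>

definition dual_system ::
  "('a::field) form \<Rightarrow> nat \<Rightarrow> (nat \<Rightarrow> nat \<Rightarrow> 'a) \<Rightarrow> (nat \<Rightarrow> nat \<Rightarrow> 'a) \<Rightarrow> bool" where
  "dual_system B t X Y \<longleftrightarrow> (\<forall>a<t. \<forall>b<t. B (X a) (Y b) = (if a = b then 1 else 0))"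

definition rank_bound :: "('a::field) form \<Rightarrow> nat \<Rightarrow> bool" where
  "rank_bound B r \<longleftrightarrow> (\<forall>t X Y. dual_system B t X Y \<longrightarrow> t \<le> r)"

lemma rank_boundD: "rank_bound B r \<Longrightarrow> dual_system B t X Y \<Longrightarrow> t \<le> r"
  by (auto simp: rank_bound_def)

lemma dual_systemD:
  "dual_system B t X Y \<Longrightarrow> a < t \<Longrightarrow> b < t \<Longrightarrow> B (X a) (Y b) = (if a = b then 1 else 0)"
  by (simp add: dual_system_def)

lemma sum_dual_left:
  assumes "dual_system B t X Y" "b < t"
  shows "(\<Sum>l<t. c l * B (X l) (Y b)) = c b"
proof -
  have "(\<Sum>l<t. c l * B (X l) (Y b)) = (\<Sum>l<t. if l = b then c b else 0)"
    using assms by (intro sum.cong) (auto simp: dual_system_def)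
  then show ?thesis using assms(2) by simp
qed

lemma sum_dual_right:
  assumes "dual_system B t X Y" "a < t"
  shows "(\<Sum>l<t. c l * B (X a) (Y l)) = c a"
proof -
  have "(\<Sum>l<t. c l * B (X a) (Y l)) = (\<Sum>l<t. if l = a then c a else 0)"
    using assms by (intro sum.cong) (auto simp: dual_system_def)
  then show ?thesis using assms(2) by simp
qed

text \<open>A Gram-Schmidt step: subtracting from \<open>x\<close> and \<open>y\<close> their
  components along the system leaves vectors that pair to zero with it, and the value of
  \<open>B\<close> on them is exactly the error of the expansion at \<open>x\<close>,
  \<open>y\<close>. The old vectors keep their positions, so a system can be grown from a prescribed
  start.\<close>

lemma extend_dual_system:
  assumes bil: "bilinear_form B" and dual: "dual_system B t X Y"
    and neq: "B x y \<noteq> (\<Sum>l<t. B x (Y l) * B (X l) y)"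
  shows "\<exists>u v. dual_system B (Suc t) (X(t := u)) (Y(t := v))"
proof -
  define x' where "x' = (\<lambda>i. x i - (\<Sum>l<t. B x (Y l) * X l i))"
  define v where "v = (\<lambda>i. y i - (\<Sum>l<t. B (X l) y * Y l i))"
  have x': "B x' z = B x z - (\<Sum>l<t. B x (Y l) * B (X l) z)" for z
    unfolding x'_def by (rule bilinear_form_diff_sum_left[OF bil])
  have v: "B z v = B z y - (\<Sum>l<t. B (X l) y * B z (Y l))" for z
    unfolding v_def by (rule bilinear_form_diff_sum_right[OF bil])
  have x'0: "B x' (Y b) = 0" if "b < t" for b
    using x' sum_dual_left[OF dual that] by simp
  have v0: "B (X a) v = 0" if "a < t" for a
    using v sum_dual_right[OF dual that] by simp
  have "B x' v = B x' y" by (subst v) (simp add: x'0)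
  then have ne: "B x' v \<noteq> 0" using neq x'[of y] by simp
  define u where "u = (\<lambda>i. inverse (B x' v) * x' i)"
  have u: "B u z = inverse (B x' v) * B x' z" for z
    unfolding u_def by (rule bilinear_form_scale_left[OF bil])
  have "dual_system B (Suc t) (X(t := u)) (Y(t := v))"
    using dual ne by (auto simp: dual_system_def less_Suc_eq u x'0 v0)
  then show ?thesis by blast
qed

text \<open>Extending as long as the expansion fails must stop by size \<open>r\<close>. That the
  given system survives as initial segment is what lets the halving argument discard the first
  \<open>s\<close> terms.\<close>

lemma maximal_dual_system:
  assumes bil: "bilinear_form B" and "dual_system B s X Y"
    and bound: "rank_bound B r"
  shows "\<exists>t X' Y'. s \<le> t \<and> t \<le> r \<and> dual_system B t X' Y' \<and>
    (\<forall>l<s. X' l = X l \<and> Y' l = Y l) \<and> (\<forall>x y. B x y = (\<Sum>l<t. B x (Y' l) * B (X' l) y))"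
  using assms(2)
proof (induction "r - s" arbitrary: s X Y rule: less_induct)
  case less
  show ?case
  proof (cases "\<forall>x y. B x y = (\<Sum>l<s. B x (Y l) * B (X l) y)")
    case True
    then show ?thesis using less.prems rank_boundD[OF bound] by blast
  next
    case False
    then obtain u v where uv: "dual_system B (Suc s) (X(s := u)) (Y(s := v))"
      using extend_dual_system[OF bil less.prems] by blast
    then have "Suc s \<le> r" by (rule rank_boundD[OF bound])
    then have "r - Suc s < r - s" by simp
    from less.hyps[OF this uv] obtain t X' Y' where t: "Suc s \<le> t"
      and *: "t \<le> r \<and> dual_system B t X' Y'"
      "\<forall>l<Suc s. X' l = (X(s := u)) l \<and> Y' l = (Y(s := v)) l"
      "\<forall>x y. B x y = (\<Sum>l<t. B x (Y' l) * B (X' l) y)" by blast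
    have "s \<le> t" using t by simp
    moreover have "\<forall>l<s. X' l = X l \<and> Y' l = Y l" using *(2) by simp
    ultimately show ?thesis using *(1,3) by blast
  qed
qed

lemma bilinear_form_add:
  "bilinear_form A \<Longrightarrow> bilinear_form B \<Longrightarrow> bilinear_form (\<lambda>x y. A x y + B x y)"
  by (simp add: bilinear_form_def algebra_simps)

text \<open>If \<open>M\<close> has a dual system of size \<open>s\<close> between the two kernels of \<open>A\<close>, then after clearing the cross
  terms \<open>M\<close> and \<open>A + M\<close> both restrict to the span of the system of \<open>A\<close> with rank at most \<open>r - s\<close>;
  their difference is the identity there. This replaces the usual argument that the kernel block of
  \<open>M\<close> vanishes, which fails over small fields.\<close>

lemma dual_system_halving:
  fixes A M :: "('a::field) form"
  assumes bA: "bilinear_form A" and bM: "bilinear_form M"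
    and boundM: "rank_bound M r" and boundS: "rank_bound (\<lambda>x y. A x y + M x y) r"
    and dA: "dual_system A r a b" and dM: "dual_system M s x y"
    and x0: "\<And>k v. k < s \<Longrightarrow> A (x k) v = 0" and y0: "\<And>k u. k < s \<Longrightarrow> A u (y k) = 0"
  shows "2 * s \<le> r"
proof -
  define a' where "a' = (\<lambda>i n. a i n - (\<Sum>k<s. M (a i) (y k) * x k n))"
  define b' where "b' = (\<lambda>j n. b j n - (\<Sum>k<s. M (x k) (b j) * y k n))"
  have a': "N (a' i) v = N (a i) v - (\<Sum>k<s. M (a i) (y k) * N (x k) v)"
    if "bilinear_form N" for N i v
    unfolding a'_def by (rule bilinear_form_diff_sum_left[OF that])
  have b': "N v (b' j) = N v (b j) - (\<Sum>k<s. M (x k) (b j) * N v (y k))"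
    if "bilinear_form N" for N j v
    unfolding b'_def by (rule bilinear_form_diff_sum_right[OF that])
  have Aab: "A (a' i) (b' j) = (if i = j then 1 else 0)" if "i < r" "j < r" for i j
    using dual_systemD[OF dA that] by (simp add: a'[OF bA] b'[OF bA] x0 y0)
  have M1: "M (a' i) (y k) = 0" if "k < s" for i k
    using sum_dual_left[OF dM that] by (simp add: a'[OF bM])
  have M2: "M (x k) (b' j) = 0" if "k < s" for j k
    using sum_dual_right[OF dM that] by (simp add: b'[OF bM])
  \<comment> \<open>\<open>N\<close> will be \<open>M\<close> and \<open>A + M\<close>: both have
    the dual system \<open>x\<close>, \<open>y\<close>, since \<open>A\<close> kills each
    \<open>y k\<close>. Completing it gives an expansion of at most \<open>r\<close> terms, the
    first \<open>s\<close> of which vanish on the vectors \<open>a'\<close>; padding with zeros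
    gives both factorisations the index set \<open>{s..<r}\<close>.\<close>
  have factor: "\<exists>P Q. \<forall>i j. N (a' i) (b' j) = (\<Sum>l\<in>{s..<r}. P i l * Q l j :: 'a)"
    if bN: "bilinear_form N" and bound: "rank_bound N r"
      and N: "\<And>u k. k < s \<Longrightarrow> N u (y k) = M u (y k)"
    for N
  proof -
    have dN: "dual_system N s x y" using dM N by (simp add: dual_system_def)
    obtain t X' Y' where t: "s \<le> t" "t \<le> r"
      and Y': "\<forall>l<s. X' l = x l \<and> Y' l = y l"
      and eq: "\<And>x y. N x y = (\<Sum>l<t. N x (Y' l) * N (X' l) y)"
      using maximal_dual_system[OF bN dN bound] by blast
    have "N (a' i) (b' j) =
        (\<Sum>l\<in>{s..<r}. (if l < t then N (a' i) (Y' l) else 0) * N (X' l) (b' j))" for i j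
    proof -
      have "N (a' i) (b' j) = (\<Sum>l<t. N (a' i) (Y' l) * N (X' l) (b' j))" by (rule eq)
      also have "\<dots> = (\<Sum>l\<in>{s..<r}. (if l < t then N (a' i) (Y' l) else 0) * N (X' l) (b' j))"
        using t Y' N M1 by (intro sum.mono_neutral_cong) auto
      finally show ?thesis .
    qed
    then show ?thesis
      by (intro exI[of _ "\<lambda>i l. if l < t then N (a' i) (Y' l) else 0"]
          exI[of _ "\<lambda>l j. N (X' l) (b' j)"]) blast
  qed
  obtain P Q where PQ: "\<And>i j. M (a' i) (b' j) = (\<Sum>l\<in>{s..<r}. P i l * Q l j)"
    using factor[OF bM boundM] by blast
  obtain P' Q' where PQ': "\<And>i j. A (a' i) (b' j) + M (a' i) (b' j) = (\<Sum>l\<in>{s..<r}. P' i l * Q' l j)"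
    using factor[OF bilinear_form_add[OF bA bM] boundS] y0 by force
  \<comment> \<open>The disjoint sum concatenates the two factorisations, with the sign of the
    difference in \<open>- P\<close>; counting indices then yields
    \<open>r \<le> 2 * (r - s)\<close>.\<close>
  define L where "L = {s..<r} <+> {s..<r}"
  have "card {..<r} \<le> card L"
  proof (rule diagonal_factor_card_le[where d = "\<lambda>_. 1 :: 'a"
        and P = "\<lambda>i. case_sum (\<lambda>l. - P i l) (\<lambda>l. P' i l)" and Q = "case_sum Q Q'"])
    fix i j assume ij: "i \<in> {..<r}" "j \<in> {..<r}"
    have "(\<Sum>l\<in>L. case_sum (\<lambda>l. - P i l) (\<lambda>l. P' i l) l * case_sum Q Q' l j)
        = - (\<Sum>l\<in>{s..<r}. P i l * Q l j) + (\<Sum>l\<in>{s..<r}. P' i l * Q' l j)"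
      unfolding L_def by (subst sum.Plus) (auto simp: sum_negf)
    also have "\<dots> = A (a' i) (b' j)" by (simp flip: PQ PQ')
    finally show "(\<Sum>l\<in>L. case_sum (\<lambda>l. - P i l) (\<lambda>l. P' i l) l * case_sum Q Q' l j)
        = (if i = j then 1 else 0)" using Aab ij by simp
  qed (auto simp: L_def)
  then have "r \<le> 2 * (r - s)" by (simp add: L_def card_Plus)
  moreover have "s \<le> r" by (rule rank_boundD[OF boundM dM])
  ultimately show ?thesis by simp
qed

section \<open>Common row and column functionals for a space of forms\<close>

lemma sum_lessThan_append:
  fixes f g :: "nat \<Rightarrow> 'a::comm_monoid_add"
  shows "(\<Sum>l<m. f l) + (\<Sum>l<n. g l) = (\<Sum>l<m + n. if l < m then f l else g (l - m))"
  by (induction n) (simp_all add: add.assoc[symmetric])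

text \<open>Addition is the one operation on members that halving performs, when it compares
  \<open>M\<close> with \<open>A + M\<close>.\<close>

definition form_space :: "('a::field) form set \<Rightarrow> bool" where
  "form_space V \<longleftrightarrow> (\<forall>M\<in>V. bilinear_form M) \<and> (\<forall>M\<in>V. \<forall>N\<in>V. (\<lambda>x y. M x y + N x y) \<in> V)"

definition max_rank :: "('a::field) form set \<Rightarrow> nat \<Rightarrow> bool" where
  "max_rank V r \<longleftrightarrow> (\<exists>M\<in>V. \<exists>X Y. dual_system M r X Y) \<and>
     (\<forall>M\<in>V. rank_bound M r)"

lemma max_rank_exists:
  assumes "M \<in> V" and bound: "\<forall>M\<in>V. rank_bound M n"
  shows "\<exists>r. max_rank V r"
proof -
  define P where "P = (\<lambda>t. \<exists>M\<in>V. \<exists>X Y. dual_system M t X Y)"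
  have P0: "P 0" using assms(1) by (auto simp: P_def dual_system_def)
  have le: "\<And>t. P t \<Longrightarrow> t \<le> n" using bound unfolding P_def rank_bound_def by blast
  have "P (GREATEST t. P t)" by (rule GreatestI_nat[of P 0 n, OF P0 le])
  moreover have "\<And>t. P t \<Longrightarrow> t \<le> (GREATEST t. P t)" by (rule Greatest_le_nat[of P _ n, OF _ le])
  ultimately have "max_rank V (GREATEST t. P t)"
    unfolding max_rank_def rank_bound_def P_def by blast
  then show ?thesis by blast
qed

text \<open>With \<open>A\<close> of maximal rank \<open>r\<close>, splitting off its row and column space costs \<open>2 * r\<close> terms and leaves
  a space of forms on the kernels of maximal rank at most \<open>r / 2\<close>; the costs sum to \<open>4 * r\<close>.\<close>

lemma max_rank_decomposition:
  fixes V :: "('a::field) form set"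
  assumes "form_space V" "max_rank V r"
  shows "\<exists>s f g f' g'. s \<le> 2 * r \<and> (\<forall>M\<in>V. \<forall>x y. M x y =
           (\<Sum>l<s. f l x * g M l y) + (\<Sum>l<s. g' M l x * f' l y))"
  using assms
proof (induction r arbitrary: V rule: less_induct)
  case (less r)
  from less.prems have bil: "\<And>M. M \<in> V \<Longrightarrow> bilinear_form M"
    and add: "\<And>M N. M \<in> V \<Longrightarrow> N \<in> V \<Longrightarrow> (\<lambda>x y. M x y + N x y) \<in> V"
    and bound: "\<And>M. M \<in> V \<Longrightarrow> rank_bound M r"
    unfolding form_space_def max_rank_def by blast+
  from less.prems obtain A a b where A: "A \<in> V" and dA: "dual_system A r a b"
    unfolding max_rank_def by blast
  have bA: "bilinear_form A" by (rule bil[OF A])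
  have eqA: "A x y = (\<Sum>l<r. A x (b l) * A (a l) y)" for x y
    using extend_dual_system[OF bA dA, of x y] rank_boundD[OF bound[OF A], of "Suc r"]
    by (meson not_less_eq_eq order_refl)
  \<comment> \<open>\<pi> and \<rho> project along the dual system onto the left and the right
    kernel of \<open>A\<close>; \<open>c M\<close> below is the compression of \<open>M\<close> to
    these kernels.\<close>
  define \<pi> where "\<pi> = (\<lambda>x i. x i - (\<Sum>l<r. A x (b l) * a l i))"
  define \<rho> where "\<rho> = (\<lambda>y i. y i - (\<Sum>l<r. A (a l) y * b l i))"
  have \<pi>: "M (\<pi> x) y = M x y - (\<Sum>l<r. A x (b l) * M (a l) y)" if "bilinear_form M" for M x y
    unfolding \<pi>_def by (rule bilinear_form_diff_sum_left[OF that])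
  have \<rho>: "M x (\<rho> y) = M x y - (\<Sum>l<r. A (a l) y * M x (b l))" if "bilinear_form M" for M x y
    unfolding \<rho>_def by (rule bilinear_form_diff_sum_right[OF that])
  have A\<pi>: "A (\<pi> x) y = 0" for x y by (simp only: \<pi>[OF bA] eqA[of x y, symmetric] diff_self)
  have A\<rho>: "A x (\<rho> y) = 0" for x y
    using \<rho>[OF bA, of x y] by (simp only: eqA[of x y] mult.commute diff_self)
  have \<pi>_lin: "\<pi> (\<lambda>i. x i + c * x' i) = (\<lambda>i. \<pi> x i + c * \<pi> x' i)" for x x' c
    unfolding \<pi>_def bilinear_form_left[OF bA]
    by (simp add: algebra_simps sum.distrib sum_distrib_left)
  have \<rho>_lin: "\<rho> (\<lambda>i. x i + c * x' i) = (\<lambda>i. \<rho> x i + c * \<rho> x' i)" for x x' c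
    unfolding \<rho>_def bilinear_form_right[OF bA]
    by (simp add: algebra_simps sum.distrib sum_distrib_left)
  define c where "c = (\<lambda>M x y. M (\<pi> x) (\<rho> y) :: 'a)"
  \<comment> \<open>Removing the component of \<open>x\<close> costs \<open>r\<close> terms whose
    functionals of \<open>x\<close> are the same for all \<open>M\<close>; removing that of
    \<open>y\<close> costs \<open>r\<close> terms with such functionals of \<open>y\<close>.\<close>
  have split: "M x y = (\<Sum>l<r. A x (b l) * M (a l) y) + (\<Sum>l<r. M (\<pi> x) (b l) * A (a l) y) + c M x y"
    if "M \<in> V" for M x y
  proof -
    have "M x y = (\<Sum>l<r. A x (b l) * M (a l) y) + M (\<pi> x) y"
      using \<pi>[OF bil[OF that], of x y] by simp
    also have "M (\<pi> x) y = (\<Sum>l<r. M (\<pi> x) (b l) * A (a l) y) + c M x y"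
      using \<rho>[OF bil[OF that], of "\<pi> x" y] by (simp add: c_def mult.commute)
    finally show ?thesis by (simp only: add.assoc)
  qed
  have bil_c: "bilinear_form (c M)" if "M \<in> V" for M
  proof -
    have b: "bilinear_form M" by (rule bil[OF that])
    show ?thesis
      unfolding bilinear_form_def c_def \<pi>_lin \<rho>_lin
      by (simp add: bilinear_form_left[OF b] bilinear_form_right[OF b])
  qed
  show ?case
  proof (cases "r = 0")
    case True
    \<comment> \<open>Halving makes no progress at rank zero, but there a nonzero value would
      already be a dual system of size one.\<close>
    have "M x y = 0" if M: "M \<in> V" for M x y
    proof (rule ccontr)
      assume "M x y \<noteq> 0"
      then obtain u v where "dual_system M (Suc 0) (a(0 := u)) (b(0 := v))"
        using extend_dual_system[OF bil[OF M], of 0 a b x y] by (auto simp: dual_system_def)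
      then show False using rank_boundD[OF bound[OF M]] True by fastforce
    qed
    then show ?thesis by (intro exI[of _ 0]) auto
  next
    case False
    \<comment> \<open>A dual system of the compression, pushed through the projections, is a dual
      system of \<open>M\<close> between the kernels of \<open>A\<close>.\<close>
    have half: "2 * t \<le> r" if M: "M \<in> V" and d: "dual_system (c M) t X Y" for M t X Y
    proof (rule dual_system_halving[OF bA bil[OF M] bound[OF M] bound[OF add[OF A M]] dA])
      show "dual_system M t (\<lambda>k. \<pi> (X k)) (\<lambda>k. \<rho> (Y k))"
        using d by (simp add: dual_system_def c_def)
    qed (auto simp: A\<pi> A\<rho>)
    have "rank_bound N r" if "N \<in> c ` V" for N
      using that half unfolding rank_bound_def by force
    then obtain r' where max: "max_rank (c ` V) r'"
      using max_rank_exists[of "c A" "c ` V" r] A by blast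
    then have r': "2 * r' \<le> r" using half unfolding max_rank_def by blast
    have "form_space (c ` V)"
      unfolding form_space_def
    proof (intro conjI ballI)
      fix M N assume "M \<in> c ` V" "N \<in> c ` V"
      then obtain M' N' where *: "M' \<in> V" "N' \<in> V" "M = c M'" "N = c N'" by auto
      have "(\<lambda>x y. M x y + N x y) = c (\<lambda>x y. M' x y + N' x y)" by (simp add: * c_def)
      then show "(\<lambda>x y. M x y + N x y) \<in> c ` V" using add[OF *(1,2)] by blast
    qed (use bil_c in auto)
    then have "\<exists>s f g f' g'. s \<le> 2 * r' \<and> (\<forall>M\<in>c ` V. \<forall>x y. M x y =
           (\<Sum>l<s. f l x * g M l y) + (\<Sum>l<s. g' M l x * f' l y))"
      using r' False by (intro less.IH max) auto
    then obtain s f g f' g' where s: "s \<le> 2 * r'" and dec0: "\<forall>M\<in>c ` V. \<forall>x y. M x y =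
           (\<Sum>l<s. f l x * g M l y) + (\<Sum>l<s. g' M l x * f' l y)"
      by (elim exE conjE)
    have dec: "c M x y = (\<Sum>l<s. f l x * g (c M) l y) + (\<Sum>l<s. g' (c M) l x * f' l y)"
      if "M \<in> V" for M x y
      by (rule dec0[rule_format, OF imageI[OF that]])
    define F where "F = (\<lambda>l x. if l < r then A x (b l) else f (l - r) x)"
    define G where "G = (\<lambda>M l y. if l < r then M (a l) y else g (c M) (l - r) y)"
    define F' where "F' = (\<lambda>l y. if l < r then A (a l) y else f' (l - r) y)"
    define G' where "G' = (\<lambda>M l x. if l < r then M (\<pi> x) (b l) else g' (c M) (l - r) x)"
    have dec': "M x y = (\<Sum>l<r + s. F l x * G M l y) + (\<Sum>l<r + s. G' M l x * F' l y)"
      if "M \<in> V" for M x y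
    proof -
      have "M x y = ((\<Sum>l<r. A x (b l) * M (a l) y) + (\<Sum>l<s. f l x * g (c M) l y))
          + ((\<Sum>l<r. M (\<pi> x) (b l) * A (a l) y) + (\<Sum>l<s. g' (c M) l x * f' l y))"
        by (subst split[OF that], subst dec[OF that]) (simp only: ac_simps)
      also have "(\<Sum>l<r. A x (b l) * M (a l) y) + (\<Sum>l<s. f l x * g (c M) l y)
          = (\<Sum>l<r + s. F l x * G M l y)"
        unfolding sum_lessThan_append by (intro sum.cong) (auto simp: F_def G_def)
      also have "(\<Sum>l<r. M (\<pi> x) (b l) * A (a l) y) + (\<Sum>l<s. g' (c M) l x * f' l y)
          = (\<Sum>l<r + s. G' M l x * F' l y)"
        unfolding sum_lessThan_append by (intro sum.cong) (auto simp: F'_def G'_def)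
      finally show ?thesis .
    qed
    \<comment> \<open>Each of the two families has \<open>r\<close> new terms and
      \<open>s \<le> 2 * r' \<le> r\<close> terms from the recursion.\<close>
    have "r + s \<le> 2 * r" using s r' by simp
    with dec' show ?thesis
      by (intro exI[of _ "r + s"] exI[of _ F] exI[of _ G] exI[of _ F'] exI[of _ G']) simp
  qed
qed

section \<open>Restrictions and Kronecker products\<close>

definition box :: "nat \<Rightarrow> nat \<Rightarrow> nat \<Rightarrow> (nat \<times> nat \<times> nat) set" where
  "box n1 n2 n3 = {..<n1} \<times> {..<n2} \<times> {..<n3}"

lemma finite_box [simp]: "finite (box n1 n2 n3)"
  by (simp add: box_def)

lemma sum_box: "(\<Sum>(i, j, k)\<in>box n1 n2 n3. f i j k) = (\<Sum>i<n1. \<Sum>j<n2. \<Sum>k<n3. f i j k)"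
  by (simp add: box_def sum.cartesian_product)

lemma sum_box_prod:
  fixes f g h :: "nat \<Rightarrow> 'a::comm_ring_1"
  shows "(\<Sum>(i, j, k)\<in>box n1 n2 n3. f i * g j * h k) = (\<Sum>i<n1. f i) * (\<Sum>j<n2. g j) * (\<Sum>k<n3. h k)"
  by (simp add: sum_box sum_distrib_left[symmetric] sum_distrib_right[symmetric] mult.assoc)

text \<open>Agreement is demanded only inside the target box, and \<open>T\<close> is read only
  inside its own, so targets such as \<open>of_bool (b = c)\<close> need no cut-off. The linear maps
  are bare coefficient functions, which compose without dimension conditions.\<close>

definition restricts_to ::
  "nat \<times> nat \<times> nat \<Rightarrow> ('a::comm_ring_1) tensor3 \<Rightarrow> nat \<times> nat \<times> nat \<Rightarrow> 'a tensor3 \<Rightarrow> bool" where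
  "restricts_to n T p S \<longleftrightarrow> (case (n, p) of ((n1, n2, n3), (p1, p2, p3)) \<Rightarrow>
     \<exists>X Y Z. \<forall>a<p1. \<forall>b<p2. \<forall>c<p3.
       S a b c = (\<Sum>(i, j, k)\<in>box n1 n2 n3. X a i * Y b j * Z c k * T i j k))"

lemma restricts_toI:
  assumes "\<And>a b c. a < p1 \<Longrightarrow> b < p2 \<Longrightarrow> c < p3 \<Longrightarrow>
     S a b c = (\<Sum>(i, j, k)\<in>box n1 n2 n3. X a i * Y b j * Z c k * T i j k)"
  shows "restricts_to (n1, n2, n3) T (p1, p2, p3) S"
  using assms unfolding restricts_to_def by auto

lemma restricts_to_smaller:
  assumes "restricts_to (n1, n2, n3) T (p1, p2, p3) S" "q1 \<le> p1" "q2 \<le> p2" "q3 \<le> p3"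
  shows "restricts_to (n1, n2, n3) T (q1, q2, q3) S"
proof -
  obtain X Y Z where "\<forall>a<p1. \<forall>b<p2. \<forall>c<p3.
      S a b c = (\<Sum>(i, j, k)\<in>box n1 n2 n3. X a i * Y b j * Z c k * T i j k)"
    using assms(1) unfolding restricts_to_def by auto
  then show ?thesis using assms(2-) by (intro restricts_toI[where X = X and Y = Y and Z = Z]) auto
qed

lemma restricts_to_trans:
  assumes "restricts_to (n1, n2, n3) T (p1, p2, p3) S" "restricts_to (p1, p2, p3) S (q1, q2, q3) U"
  shows "restricts_to (n1, n2, n3) T (q1, q2, q3) U"
proof -
  obtain X Y Z where "\<forall>a<p1. \<forall>b<p2. \<forall>c<p3.
     S a b c = (\<Sum>(i, j, k)\<in>box n1 n2 n3. X a i * Y b j * Z c k * T i j k)"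
    using assms(1) unfolding restricts_to_def by auto
  note S = this[rule_format]
  obtain X' Y' Z' where "\<forall>a<q1. \<forall>b<q2. \<forall>c<q3.
     U a b c = (\<Sum>(i, j, k)\<in>box p1 p2 p3. X' a i * Y' b j * Z' c k * S i j k)"
    using assms(2) unfolding restricts_to_def by auto
  note U = this[rule_format]
  show ?thesis
  proof (rule restricts_toI[where X = "\<lambda>a i. \<Sum>x<p1. X' a x * X x i"
        and Y = "\<lambda>b j. \<Sum>y<p2. Y' b y * Y y j" and Z = "\<lambda>c k. \<Sum>z<p3. Z' c z * Z z k"])
    fix a b c assume *: "a < q1" "b < q2" "c < q3"
    have "U a b c = (\<Sum>(x, y, z)\<in>box p1 p2 p3. X' a x * Y' b y * Z' c z *
        (\<Sum>(i, j, k)\<in>box n1 n2 n3. X x i * Y y j * Z z k * T i j k))"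
      unfolding U[OF *] by (intro sum.cong) (auto simp: box_def S)
    also have "\<dots> = (\<Sum>(x, y, z)\<in>box p1 p2 p3. \<Sum>(i, j, k)\<in>box n1 n2 n3.
        ((X' a x * X x i) * (Y' b y * Y y j) * (Z' c z * Z z k)) * T i j k)"
      by (intro sum.cong refl) (auto simp: sum_distrib_left case_prod_unfold ac_simps intro!: sum.cong)
    also have "\<dots> = (\<Sum>(i, j, k)\<in>box n1 n2 n3. \<Sum>(x, y, z)\<in>box p1 p2 p3.
        ((X' a x * X x i) * (Y' b y * Y y j) * (Z' c z * Z z k)) * T i j k)"
      unfolding case_prod_unfold by (rule sum.swap)
    also have "\<dots> = (\<Sum>(i, j, k)\<in>box n1 n2 n3.
        (\<Sum>x<p1. X' a x * X x i) * (\<Sum>y<p2. Y' b y * Y y j) * (\<Sum>z<p3. Z' c z * Z z k) * T i j k)"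
      unfolding sum_box_prod[symmetric]
      by (intro sum.cong refl) (auto simp: sum_distrib_right case_prod_unfold)
    finally show "U a b c = \<dots>" .
  qed
qed

section \<open>Kronecker products of restrictions\<close>

lemma pair_index_less: "i < m \<Longrightarrow> j < n \<Longrightarrow> i * n + j < m * (n :: nat)"
proof -
  assume "i < m" "j < n"
  then have "i * n + j < (i + 1) * n" by simp
  also have "\<dots> \<le> m * n" using \<open>i < m\<close> by (intro mult_le_mono) auto
  finally show ?thesis .
qed

lemma sum_box_kronecker:
  "(\<Sum>(i, j, k)\<in>box (n1 * m1) (n2 * m2) (n3 * m3). F i j k) =
   (\<Sum>(i, j, k)\<in>box n1 n2 n3. \<Sum>(i', j', k')\<in>box m1 m2 m3. F (i * m1 + i') (j * m2 + j') (k * m3 + k'))"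
  unfolding sum.cartesian_product case_prod_unfold
  by (rule sum.reindex_bij_witness[where
        i = "\<lambda>((i, j, k), (i', j', k')). (i * m1 + i', j * m2 + j', k * m3 + k')"
        and j = "\<lambda>(i, j, k). ((i div m1, j div m2, k div m3), (i mod m1, j mod m2, k mod m3))"])
    (auto simp: box_def pair_index_less less_mult_imp_div_less,
     (metis gr_zeroI less_nat_zero_code mod_less_divisor mult_0_right)+)

lemma sum_box_kronecker_mult:
  fixes f g :: "'a::comm_ring_1 tensor3"
  shows "(\<Sum>(i, j, k)\<in>box (n1 * m1) (n2 * m2) (n3 * m3).
     f (i div m1) (j div m2) (k div m3) * g (i mod m1) (j mod m2) (k mod m3)) =
   (\<Sum>(i, j, k)\<in>box n1 n2 n3. f i j k) * (\<Sum>(i, j, k)\<in>box m1 m2 m3. g i j k)"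
  by (subst sum_box_kronecker, unfold sum_product case_prod_unfold)
    (intro sum.cong refl, auto simp: box_def)

lemma restricts_to_kronecker:
  assumes "restricts_to (n1, n2, n3) T (p1, p2, p3) S" "restricts_to (m1, m2, m3) T' (q1, q2, q3) S'"
  shows "restricts_to (n1 * m1, n2 * m2, n3 * m3) (kronecker m1 m2 m3 T T')
     (p1 * q1, p2 * q2, p3 * q3) (kronecker q1 q2 q3 S S')"
proof -
  obtain X Y Z where "\<forall>a<p1. \<forall>b<p2. \<forall>c<p3.
     S a b c = (\<Sum>(i, j, k)\<in>box n1 n2 n3. X a i * Y b j * Z c k * T i j k)"
    using assms(1) unfolding restricts_to_def by auto
  note S = this[rule_format]
  obtain X' Y' Z' where "\<forall>a<q1. \<forall>b<q2. \<forall>c<q3.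
     S' a b c = (\<Sum>(i, j, k)\<in>box m1 m2 m3. X' a i * Y' b j * Z' c k * T' i j k)"
    using assms(2) unfolding restricts_to_def by auto
  note S' = this[rule_format]
  have md: "a mod q < q" if "a < p * q" for a p q :: nat
    using that by (cases "q = 0") auto
  show ?thesis
  proof (rule restricts_toI[where X = "\<lambda>a i. X (a div q1) (i div m1) * X' (a mod q1) (i mod m1)"
        and Y = "\<lambda>a i. Y (a div q2) (i div m2) * Y' (a mod q2) (i mod m2)"
        and Z = "\<lambda>a i. Z (a div q3) (i div m3) * Z' (a mod q3) (i mod m3)"])
    fix a b c assume *: "a < p1 * q1" "b < p2 * q2" "c < p3 * q3"
    have "kronecker q1 q2 q3 S S' a b c =
      (\<Sum>(i, j, k)\<in>box n1 n2 n3. X (a div q1) i * Y (b div q2) j * Z (c div q3) k * T i j k) *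
      (\<Sum>(i, j, k)\<in>box m1 m2 m3. X' (a mod q1) i * Y' (b mod q2) j * Z' (c mod q3) k * T' i j k)"
      unfolding kronecker_def using * by (simp add: S S' less_mult_imp_div_less md)
    then show "kronecker q1 q2 q3 S S' a b c = (\<Sum>(i, j, k)\<in>box (n1 * m1) (n2 * m2) (n3 * m3).
       X (a div q1) (i div m1) * X' (a mod q1) (i mod m1) *
       (Y (b div q2) (j div m2) * Y' (b mod q2) (j mod m2)) *
       (Z (c div q3) (k div m3) * Z' (c mod q3) (k mod m3)) * kronecker m1 m2 m3 T T' i j k)"
      unfolding sum_box_kronecker_mult[symmetric] kronecker_def by (simp add: ac_simps)
  qed
qed

lemma sum_box_pick:
  fixes T :: "'a::comm_ring_1 tensor3"
  assumes "a < n1" "b < n2" "c < n3"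
  shows "(\<Sum>(i, j, k)\<in>box n1 n2 n3. of_bool (i = a) * of_bool (j = b) * of_bool (k = c) * T i j k) = T a b c"
  using assms
  by (subst sum.mono_neutral_cong_right[where S = "{(a, b, c)}"
        and h = "\<lambda>(i, j, k). T i j k"]) (auto simp: box_def of_bool_def split: if_splits)

lemma restricts_to_refl: "restricts_to (n1, n2, n3) T (n1, n2, n3) T"
  by (rule restricts_toI[where X = "\<lambda>a i. of_bool (i = a)" and Y = "\<lambda>a i. of_bool (i = a)"
        and Z = "\<lambda>a i. of_bool (i = a)"], rule sum_box_pick[symmetric])

lemma restricts_to_power:
  assumes "restricts_to (n1, n2, n3) T (p1, p2, p3) S"
  shows "restricts_to (n1 ^ m, n2 ^ m, n3 ^ m) (kronecker_power n1 n2 n3 T m)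
    (p1 ^ m, p2 ^ m, p3 ^ m) (kronecker_power p1 p2 p3 S m)"
proof (induction m)
  case 0
  then show ?case by (simp add: restricts_to_refl)
next
  case (Suc m)
  show ?case using restricts_to_kronecker[OF Suc assms] by (simp add: mult.commute)
qed

text \<open>The mixed-radix encoding is associative on the nose, so a power of a power equals a
  power as a function, with no reindexing. This is what allows a bound for one tensor to be applied
  to \<open>kronecker_power n1 n2 n3 T M\<close>.\<close>

lemma kronecker_assoc:
  "kronecker n1 n2 n3 (kronecker m1 m2 m3 S T) U =
   kronecker (m1 * n1) (m2 * n2) (m3 * n3) S (kronecker n1 n2 n3 T (U :: 'a::semigroup_mult tensor3))"
proof -
  have "i mod (m * n) mod n = i mod n" for i m n :: nat
    by (simp add: mod_mod_cancel)
  moreover have "i mod (m * n) div n = (i div n) mod m" for i m n :: nat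
    by (cases "n = 0") (simp_all add: mod_mult2_eq mult.commute[of m])
  moreover have "i div n div m = i div (m * n)" for i m n :: nat
    by (simp add: div_mult2_eq mult.commute[of m])
  ultimately show ?thesis by (simp add: kronecker_def mult.assoc)
qed

lemma kronecker_power_add:
  "kronecker_power n1 n2 n3 T (m + k) =
   kronecker (n1 ^ k) (n2 ^ k) (n3 ^ k) (kronecker_power n1 n2 n3 T m) (kronecker_power n1 n2 n3 T k)"
proof (induction k)
  case 0
  show ?case by (simp add: kronecker_def unit_tensor_def)
next
  case (Suc k)
  then show ?case by (simp add: kronecker_assoc mult.commute)
qed

lemma kronecker_power_mult:
  "kronecker_power (n1 ^ k) (n2 ^ k) (n3 ^ k) (kronecker_power n1 n2 n3 T k) m
   = kronecker_power n1 n2 n3 T (k * m)"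
  by (induction m) (simp_all add: kronecker_power_add add.commute[of k])

lemma unit_tensor_kronecker:
  "kronecker s s s (unit_tensor r) (unit_tensor s :: 'a::field tensor3) = unit_tensor (r * s)"
proof (intro ext)
  fix i j k
  show "kronecker s s s (unit_tensor r) (unit_tensor s) i j k = (unit_tensor (r * s) :: 'a tensor3) i j k"
  proof (cases "s = 0")
    case False
    have lt: "i < r * s \<longleftrightarrow> i div s < r"
      using False less_mult_imp_div_less div_less_iff_less_mult by blast
    have eq: "i = j \<longleftrightarrow> i div s = j div s \<and> i mod s = j mod s" for i j
      by (metis div_mult_mod_eq)
    have "unit_tensor (r * s) i j k = (if i div s < r \<and> (i div s = j div s \<and> i mod s = j mod s) \<and>
        (j div s = k div s \<and> j mod s = k mod s) then 1 else (0 :: 'a))"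
      unfolding unit_tensor_def lt eq[of i j] eq[of j k] ..
    moreover have "i mod s < s" using False by simp
    ultimately show ?thesis by (simp add: kronecker_def unit_tensor_def)
  qed (simp add: kronecker_def unit_tensor_def)
qed

text \<open>Both \<open>tensor_map\<close> and \<open>unit_tensor\<close> vanish as soon as an index
  reaches \<open>r\<close>, so equality of functions amounts to agreement inside the box.\<close>

lemma tensor_map_eq_unit_iff_restricts:
  fixes T :: "'a::field tensor3"
  shows "(\<exists>L1 L2 L3. L1 \<in> carrier_mat r n1 \<and> L2 \<in> carrier_mat r n2 \<and> L3 \<in> carrier_mat r n3 \<and>
      tensor_map L1 L2 L3 T = unit_tensor r) \<longleftrightarrow> restricts_to (n1, n2, n3) T (r, r, r) (unit_tensor r)"
proof
  assume "\<exists>L1 L2 L3. L1 \<in> carrier_mat r n1 \<and> L2 \<in> carrier_mat r n2 \<and> L3 \<in> carrier_mat r n3 \<and>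
      tensor_map L1 L2 L3 T = unit_tensor r"
  then obtain L1 L2 L3 where L: "L1 \<in> carrier_mat r n1" "L2 \<in> carrier_mat r n2" "L3 \<in> carrier_mat r n3"
    and eq: "tensor_map L1 L2 L3 T = unit_tensor r" by blast
  show "restricts_to (n1, n2, n3) T (r, r, r) (unit_tensor r)"
    by (rule restricts_toI[where X = "\<lambda>a i. L1 $$ (a, i)" and Y = "\<lambda>a i. L2 $$ (a, i)"
          and Z = "\<lambda>a i. L3 $$ (a, i)"])
      (use L in \<open>simp add: eq[symmetric] tensor_map_def sum_box\<close>)
next
  assume "restricts_to (n1, n2, n3) T (r, r, r) (unit_tensor r)"
  then obtain X Y Z where *: "\<forall>a<r. \<forall>b<r. \<forall>c<r.
      unit_tensor r a b c = (\<Sum>(i, j, k)\<in>box n1 n2 n3. X a i * Y b j * Z c k * T i j k)"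
    unfolding restricts_to_def by auto
  have "tensor_map (mat r n1 (\<lambda>(a, i). X a i)) (mat r n2 (\<lambda>(a, i). Y a i)) (mat r n3 (\<lambda>(a, i). Z a i)) T
      = unit_tensor r"
  proof (intro ext)
    fix a b c
    show "tensor_map (mat r n1 (\<lambda>(a, i). X a i)) (mat r n2 (\<lambda>(a, i). Y a i)) (mat r n3 (\<lambda>(a, i). Z a i)) T a b c
        = unit_tensor r a b c"
    proof (cases "a < r \<and> b < r \<and> c < r")
      case True
      then have "unit_tensor r a b c = (\<Sum>(i, j, k)\<in>box n1 n2 n3. X a i * Y b j * Z c k * T i j k)"
        using * by blast
      with True show ?thesis by (simp add: tensor_map_def sum_box)
    next
      case False
      then have "unit_tensor r a b c = (0 :: 'a)" by (auto simp: unit_tensor_def)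
      with False show ?thesis by (simp only: tensor_map_def dim_row_mat if_False)
    qed
  qed
  then show "\<exists>L1 L2 L3. L1 \<in> carrier_mat r n1 \<and> L2 \<in> carrier_mat r n2 \<and> L3 \<in> carrier_mat r n3 \<and>
      tensor_map L1 L2 L3 T = unit_tensor r"
    by (meson mat_carrier)
qed

text \<open>With second and third index equal, the unit tensor is the identity matrix, which thus
  factors through the \<open>n1\<close> indices of the first leg. The bound makes the
  \<open>GREATEST\<close> in \<open>subrank\<close> a maximum.\<close>

lemma restricts_to_unit_le:
  fixes T :: "'a::field tensor3"
  assumes "restricts_to (n1, n2, n3) T (r, r, r) (unit_tensor r)"
  shows "r \<le> n1"
proof -
  obtain X Y Z where *: "\<forall>a<r. \<forall>b<r. \<forall>c<r.
      unit_tensor r a b c = (\<Sum>(i, j, k)\<in>box n1 n2 n3. X a i * Y b j * Z c k * T i j k)"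
    using assms unfolding restricts_to_def by auto
  have "card {..<r} \<le> card {..<n1}"
  proof (rule diagonal_factor_card_le[where d = "\<lambda>_. 1 :: 'a" and P = X
        and Q = "\<lambda>i b. \<Sum>j<n2. \<Sum>k<n3. Y b j * Z b k * T i j k"])
    fix a b assume ab: "a \<in> {..<r}" "b \<in> {..<r}"
    have "(\<Sum>i<n1. X a i * (\<Sum>j<n2. \<Sum>k<n3. Y b j * Z b k * T i j k)) = unit_tensor r a b b"
      using * ab by (simp add: sum_box sum_distrib_left mult.assoc)
    then show "(\<Sum>i<n1. X a i * (\<Sum>j<n2. \<Sum>k<n3. Y b j * Z b k * T i j k)) = (if a = b then 1 else 0)"
      using ab by (simp add: unit_tensor_def)
  qed auto
  then show ?thesis by simp
qed

lemma subrank_eq_Greatest: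
  "subrank n1 n2 n3 T = (GREATEST r. restricts_to (n1, n2, n3) T (r, r, r) (unit_tensor r))"
  unfolding subrank_def tensor_map_eq_unit_iff_restricts ..

lemma le_subrank:
  "restricts_to (n1, n2, n3) T (r, r, r) (unit_tensor r) \<Longrightarrow> r \<le> subrank n1 n2 n3 T"
  unfolding subrank_eq_Greatest
  by (rule Greatest_le_nat[where b = n1]) (auto intro: restricts_to_unit_le)

lemma restricts_to_subrank:
  "restricts_to (n1, n2, n3) T (subrank n1 n2 n3 T, subrank n1 n2 n3 T, subrank n1 n2 n3 T)
     (unit_tensor (subrank n1 n2 n3 T))"
  unfolding subrank_eq_Greatest
proof (rule GreatestI_nat[where P = "\<lambda>r. restricts_to (n1, n2, n3) T (r, r, r) (unit_tensor r)"])
  show "restricts_to (n1, n2, n3) T (0, 0, 0) (unit_tensor 0)" by (rule restricts_toI) auto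
qed (rule restricts_to_unit_le)

lemma subrank_restricts_mono:
  assumes "restricts_to (n1, n2, n3) T (p1, p2, p3) S"
  shows "subrank p1 p2 p3 S \<le> subrank n1 n2 n3 T"
  by (rule le_subrank[OF restricts_to_trans[OF assms restricts_to_subrank]])

lemma subrank_kronecker:
  "subrank n1 n2 n3 S * subrank m1 m2 m3 T \<le> subrank (n1 * m1) (n2 * m2) (n3 * m3) (kronecker m1 m2 m3 S T)"
  using restricts_to_kronecker[OF restricts_to_subrank[of n1 n2 n3 S] restricts_to_subrank[of m1 m2 m3 T]]
  unfolding unit_tensor_kronecker by (rule le_subrank)

section \<open>Slice rank\<close>

lemma rank_one_imp_outer:
  fixes A :: "'a::field mat"
  assumes A: "A \<in> carrier_mat n nc" and rank: "vec_space.rank n A = 1"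
  shows "\<exists>f g. \<forall>i<n. \<forall>c<nc. A $$ (i, c) = f i * g c"
proof -
  interpret vec_space "TYPE('a)" n .
  let ?P = "\<lambda>T. T \<subseteq> set (cols A) \<and> lin_indpt T"
  have "lin_indpt {}" by (simp add: lin_dep_def)
  \<comment> \<open>The rank is the size of a maximal independent set of columns, here a single
    \<open>v\<close>; maximality makes every other column a multiple of it.\<close>
  then obtain S where S: "maximal S ?P" "finite S"
    using maximal_exists_superset[of "set (cols A)" ?P "{}"] by auto
  have "card S = 1" using rank_card_indpt[OF A S(1)] rank by simp
  then obtain v where v: "S = {v}" by (auto simp: card_Suc_eq)
  have car: "set (cols A) \<subseteq> carrier_vec n" using cols_dim A by blast
  have P: "v \<in> set (cols A)" "lin_indpt {v}" using S(1) by (auto simp: maximal_def v)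
  have "\<exists>g. \<forall>i<n. col A c $ i = g * v $ i" if "c < nc" for c
  proof (cases "col A c = v")
    case True
    then show ?thesis by (intro exI[of _ 1]) simp
  next
    case False
    have c: "col A c \<in> set (cols A)" using that A by (metis carrier_matD(2) cols_length cols_nth nth_mem)
    have "lin_dep (insert (col A c) {v})"
    proof (rule ccontr)
      assume "\<not> ?thesis"
      then have "?P (insert (col A c) {v})" using c P(1) by simp
      with S(1)[unfolded maximal_def v] have "insert (col A c) {v} = {v}"
        by (metis subset_insertI)
      then show False using False by simp
    qed
    then have "col A c \<in> span {v}"
      using lin_dep_iff_in_span[of "{v}" "col A c"] P c car False by auto
    moreover have "v \<in> carrier_vec n" using P car by blast
    ultimately have "\<exists>a. lincomb a {v} = col A c"
      using finite_in_span[of "{v}" "col A c"] by simp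
    then obtain a where "col A c = lincomb a {v}" by metis
    then have "col A c $ i = a v * v $ i" if "i < n" for i
      using lincomb_index[OF that, of "{v}" a] P car by auto
    then show ?thesis by blast
  qed
  then obtain g where g: "\<And>c i. c < nc \<Longrightarrow> i < n \<Longrightarrow> col A c $ i = g c * v $ i" by metis
  have "A $$ (i, c) = v $ i * g c" if "i < n" "c < nc" for i c
  proof -
    have "A $$ (i, c) = col A c $ i" using that A by simp
    also have "\<dots> = v $ i * g c" using that P(1) car by (auto simp: g mult.commute)
    finally show ?thesis .
  qed
  then show ?thesis by blast
qed

lemma outer_imp_rank_one:
  fixes A :: "'a::field mat"
  assumes A: "A \<in> carrier_mat n nc" and fg: "\<And>i c. i < n \<Longrightarrow> c < nc \<Longrightarrow> A $$ (i, c) = f i * g c"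
    and nz: "i0 < n" "c0 < nc" "A $$ (i0, c0) \<noteq> 0"
  shows "vec_space.rank n A = 1"
proof -
  interpret vec_space "TYPE('a)" n .
  have "rank A \<le> 1" by (rule rank_le_1_product_entries[OF A, of f g]) (use fg A in auto)
  moreover have "card {col A c0} \<le> rank A"
  proof (rule rank_ge_card_indpt[OF A])
    show "{col A c0} \<subseteq> set (cols A)"
      using nz A by (metis carrier_matD(2) cols_length cols_nth nth_mem empty_subsetI insert_subset)
    have nz': "col A c0 \<noteq> 0\<^sub>v n"
    proof
      assume *: "col A c0 = 0\<^sub>v n"
      have "col A c0 $ i0 = A $$ (i0, c0)" using nz A by simp
      then show False using nz by (simp add: *)
    qed
    have car: "col A c0 \<in> carrier_vec n" using nz A by auto
    show "lin_indpt {col A c0}"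
    proof
      assume "lin_dep {col A c0}"
      then obtain a where a: "lincomb a {col A c0} = 0\<^sub>v n" "a (col A c0) \<noteq> 0"
        using finite_lin_dep[of "{col A c0}"] car by auto
      have "0 = lincomb a {col A c0} $ i0" using a(1) nz by simp
      also have "\<dots> = a (col A c0) * A $$ (i0, c0)"
        using lincomb_index[OF nz(1), of "{col A c0}" a] car nz A by simp
      finally show False using a(2) nz by simp
    qed
  qed
  ultimately show ?thesis by simp
qed

definition slice_sum :: "nat \<Rightarrow> nat \<Rightarrow> nat \<Rightarrow> ('a::field) tensor3 \<Rightarrow> nat \<Rightarrow> bool" where
  "slice_sum n1 n2 n3 T s \<longleftrightarrow> (\<exists>r1 r2 r3 f1 g1 f2 g2 f3 g3. r1 + r2 + r3 \<le> s \<and>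
     (\<forall>i<n1. \<forall>j<n2. \<forall>k<n3. T i j k =
        (\<Sum>l<r1. f1 l i * g1 l j k) + (\<Sum>l<r2. f2 l j * g2 l i k) + (\<Sum>l<r3. f3 l k * g3 l i j)))"

lemma slice_sumI:
  fixes r1 r2 r3 :: nat
  assumes "r1 + r2 + r3 \<le> s"
    and "\<And>i j k. i < n1 \<Longrightarrow> j < n2 \<Longrightarrow> k < n3 \<Longrightarrow> T i j k =
        (\<Sum>l<r1. f1 l i * g1 l j k) + (\<Sum>l<r2. f2 l j * g2 l i k) + (\<Sum>l<r3. f3 l k * g3 l i j)"
  shows "slice_sum n1 n2 n3 T s"
  unfolding slice_sum_def
  by (rule exI[of _ r1], rule exI[of _ r2], rule exI[of _ r3], rule exI[of _ f1], rule exI[of _ g1],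
      rule exI[of _ f2], rule exI[of _ g2], rule exI[of _ f3], rule exI[of _ g3]) (use assms in simp)

lemma slice_sum_first_leg: "slice_sum n1 n2 n3 T n1"
  by (rule slice_sumI[where ?r1.0 = n1 and ?r2.0 = 0 and ?r3.0 = 0
        and ?f1.0 = "\<lambda>l i. of_bool (l = i)" and ?g1.0 = T])
    (simp_all add: of_bool_def if_distrib[of "\<lambda>x. x * _"] cong: if_cong)

lemma sum_append_mult:
  fixes f f' g g' :: "nat \<Rightarrow> 'a::comm_ring_1"
  shows "(\<Sum>l<m. f l * g l) + (\<Sum>l<n. f' l * g' l) =
    (\<Sum>l<m + n. (if l < m then f l else f' (l - m)) * (if l < m then g l else g' (l - m)))"
  unfolding sum_lessThan_append by (intro sum.cong) auto

lemma slice_sum_add: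
  assumes "slice_sum n1 n2 n3 S s" "slice_sum n1 n2 n3 T t"
  shows "slice_sum n1 n2 n3 (\<lambda>i j k. S i j k + T i j k) (s + t)"
proof -
  obtain r1 r2 r3 f1 g1 f2 g2 f3 g3 where S: "r1 + r2 + r3 \<le> s"
    "\<forall>i<n1. \<forall>j<n2. \<forall>k<n3. S i j k =
        (\<Sum>l<r1. f1 l i * g1 l j k) + (\<Sum>l<r2. f2 l j * g2 l i k) + (\<Sum>l<r3. f3 l k * g3 l i j)"
    using assms(1) unfolding slice_sum_def by (elim exE conjE)
  obtain r1' r2' r3' f1' g1' f2' g2' f3' g3' where T: "r1' + r2' + r3' \<le> t"
    "\<forall>i<n1. \<forall>j<n2. \<forall>k<n3. T i j k =
        (\<Sum>l<r1'. f1' l i * g1' l j k) + (\<Sum>l<r2'. f2' l j * g2' l i k) + (\<Sum>l<r3'. f3' l k * g3' l i j)"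
    using assms(2) unfolding slice_sum_def by (elim exE conjE)
  show ?thesis
  proof (rule slice_sumI[where
        ?f1.0 = "\<lambda>l i. if l < r1 then f1 l i else f1' (l - r1) i" and
        ?g1.0 = "\<lambda>l i j. if l < r1 then g1 l i j else g1' (l - r1) i j" and
        ?f2.0 = "\<lambda>l i. if l < r2 then f2 l i else f2' (l - r2) i" and
        ?g2.0 = "\<lambda>l i j. if l < r2 then g2 l i j else g2' (l - r2) i j" and
        ?f3.0 = "\<lambda>l i. if l < r3 then f3 l i else f3' (l - r3) i" and
        ?g3.0 = "\<lambda>l i j. if l < r3 then g3 l i j else g3' (l - r3) i j"])
    show "(r1 + r1') + (r2 + r2') + (r3 + r3') \<le> s + t" using S(1) T(1) by simp
    fix i j k assume *: "i < n1" "j < n2" "k < n3"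
    show "S i j k + T i j k =
      (\<Sum>l<r1 + r1'. (if l < r1 then f1 l i else f1' (l - r1) i) * (if l < r1 then g1 l j k else g1' (l - r1) j k)) +
      (\<Sum>l<r2 + r2'. (if l < r2 then f2 l j else f2' (l - r2) j) * (if l < r2 then g2 l i k else g2' (l - r2) i k)) +
      (\<Sum>l<r3 + r3'. (if l < r3 then f3 l k else f3' (l - r3) k) * (if l < r3 then g3 l i j else g3' (l - r3) i j))"
      unfolding S(2)[rule_format, OF *] T(2)[rule_format, OF *]
        sum_append_mult[of "\<lambda>l. f1 l i" "\<lambda>l. g1 l j k" r1 "\<lambda>l. f1' l i" "\<lambda>l. g1' l j k", symmetric]
        sum_append_mult[of "\<lambda>l. f2 l j" "\<lambda>l. g2 l i k" r2 "\<lambda>l. f2' l j" "\<lambda>l. g2' l i k", symmetric]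
        sum_append_mult[of "\<lambda>l. f3 l k" "\<lambda>l. g3 l i j" r3 "\<lambda>l. f3' l k" "\<lambda>l. g3' l i j", symmetric]
      by (simp only: add_ac)
  qed
qed

lemma slice_rank_one_imp_slice_sum:
  assumes "slice_rank_one n1 n2 n3 S"
  shows "slice_sum n1 n2 n3 S 1"
proof -
  consider (1) "vec_space.rank n1 (flattening1 n1 n2 n3 S) = 1"
    | (2) "vec_space.rank n2 (flattening2 n1 n2 n3 S) = 1"
    | (3) "vec_space.rank n3 (flattening3 n1 n2 n3 S) = 1"
    using assms by (auto simp: slice_rank_one_def)
  then show ?thesis
  proof cases
    case 1
    then obtain f g where fg: "\<forall>i<n1. \<forall>c<n2 * n3. flattening1 n1 n2 n3 S $$ (i, c) = f i * g c"
      using rank_one_imp_outer[of "flattening1 n1 n2 n3 S" n1 "n2 * n3"] by (auto simp: flattening1_def)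
    have "S i j k = f i * g (j * n3 + k)" if "i < n1" "j < n2" "k < n3" for i j k
      using fg[rule_format, OF that(1) pair_index_less[OF that(2,3)]] that pair_index_less[OF that(2,3)]
      by (simp add: flattening1_def)
    then show ?thesis
      by (intro slice_sumI[where ?r1.0 = 1 and ?r2.0 = 0 and ?r3.0 = 0
          and ?f1.0 = "\<lambda>_. f" and ?g1.0 = "\<lambda>_ j k. g (j * n3 + k)"]) auto
  next
    case 2
    then obtain f g where fg: "\<forall>i<n2. \<forall>c<n1 * n3. flattening2 n1 n2 n3 S $$ (i, c) = f i * g c"
      using rank_one_imp_outer[of "flattening2 n1 n2 n3 S" n2 "n1 * n3"] by (auto simp: flattening2_def)
    have "S i j k = f j * g (i * n3 + k)" if "i < n1" "j < n2" "k < n3" for i j k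
      using fg[rule_format, OF that(2) pair_index_less[OF that(1,3)]] that pair_index_less[OF that(1,3)]
      by (simp add: flattening2_def)
    then show ?thesis
      by (intro slice_sumI[where ?r1.0 = 0 and ?r2.0 = 1 and ?r3.0 = 0
          and ?f2.0 = "\<lambda>_. f" and ?g2.0 = "\<lambda>_ i k. g (i * n3 + k)"]) auto
  next
    case 3
    then obtain f g where fg: "\<forall>i<n3. \<forall>c<n1 * n2. flattening3 n1 n2 n3 S $$ (i, c) = f i * g c"
      using rank_one_imp_outer[of "flattening3 n1 n2 n3 S" n3 "n1 * n2"] by (auto simp: flattening3_def)
    have "S i j k = f k * g (i * n2 + j)" if "i < n1" "j < n2" "k < n3" for i j k
      using fg[rule_format, OF that(3) pair_index_less[OF that(1,2)]] that pair_index_less[OF that(1,2)]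
      by (simp add: flattening3_def)
    then show ?thesis
      by (intro slice_sumI[where ?r1.0 = 0 and ?r2.0 = 0 and ?r3.0 = 1
          and ?f3.0 = "\<lambda>_. f" and ?g3.0 = "\<lambda>_ i j. g (i * n2 + j)"]) auto
  qed
qed

lemma outer_imp_slice_rank_one:
  assumes S: "S \<in> tensor_space n1 n2 n3" and nz: "S \<noteq> (\<lambda>i j k. 0)"
    and outer: "(\<forall>i<n1. \<forall>j<n2. \<forall>k<n3. S i j k = f i * g j k) \<or>
      (\<forall>i<n1. \<forall>j<n2. \<forall>k<n3. S i j k = f j * g i k) \<or>
      (\<forall>i<n1. \<forall>j<n2. \<forall>k<n3. S i j k = f k * g i j)"
  shows "slice_rank_one n1 n2 n3 S"
proof -
  obtain i0 j0 k0 where nz0: "S i0 j0 k0 \<noteq> 0" using nz by (auto simp: fun_eq_iff)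
  with S have lt: "i0 < n1" "j0 < n2" "k0 < n3" by (auto simp: tensor_space_def)
  have md: "c div n < m \<and> c mod n < n" if "c < m * n" for c m n :: nat
    using that by (cases "n = 0") (auto simp: less_mult_imp_div_less)
  from outer show ?thesis
  proof (elim disjE)
    assume *: "\<forall>i<n1. \<forall>j<n2. \<forall>k<n3. S i j k = f i * g j k"
    have "vec_space.rank n1 (flattening1 n1 n2 n3 S) = 1"
      by (rule outer_imp_rank_one[where nc = "n2 * n3" and f = f and g = "\<lambda>c. g (c div n3) (c mod n3)"
            and ?i0.0 = i0 and ?c0.0 = "j0 * n3 + k0"])
        (use * lt nz0 md pair_index_less in \<open>auto simp: flattening1_def\<close>)
    then show ?thesis by (simp add: slice_rank_one_def)
  next
    assume *: "\<forall>i<n1. \<forall>j<n2. \<forall>k<n3. S i j k = f j * g i k"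
    have "vec_space.rank n2 (flattening2 n1 n2 n3 S) = 1"
      by (rule outer_imp_rank_one[where nc = "n1 * n3" and f = f and g = "\<lambda>c. g (c div n3) (c mod n3)"
            and ?i0.0 = j0 and ?c0.0 = "i0 * n3 + k0"])
        (use * lt nz0 md pair_index_less in \<open>auto simp: flattening2_def\<close>)
    then show ?thesis by (simp add: slice_rank_one_def)
  next
    assume *: "\<forall>i<n1. \<forall>j<n2. \<forall>k<n3. S i j k = f k * g i j"
    have "vec_space.rank n3 (flattening3 n1 n2 n3 S) = 1"
      by (rule outer_imp_rank_one[where nc = "n1 * n2" and f = f and g = "\<lambda>c. g (c div n2) (c mod n2)"
            and ?i0.0 = k0 and ?c0.0 = "i0 * n2 + j0"])
        (use * lt nz0 md pair_index_less in \<open>auto simp: flattening3_def\<close>)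
    then show ?thesis by (simp add: slice_rank_one_def)
  qed
qed

definition slice_decomposition :: "nat \<Rightarrow> nat \<Rightarrow> nat \<Rightarrow> ('a::field) tensor3 \<Rightarrow> nat \<Rightarrow> bool" where
  "slice_decomposition n1 n2 n3 T r \<longleftrightarrow> (\<exists>S :: nat \<Rightarrow> 'a tensor3.
     (\<forall>l<r. S l \<in> tensor_space n1 n2 n3 \<and> slice_rank_one n1 n2 n3 (S l)) \<and>
     T = (\<lambda>i j k. \<Sum>l<r. S l i j k))"

text \<open>A summand of slice rank one has a flattening of rank exactly one and so is nonzero;
  vanishing terms must go before the terms of a \<open>slice_sum\<close> count as a
  decomposition.\<close>

lemma slice_decomposition_drop_zero:
  assumes "\<forall>l<r. S l \<in> tensor_space n1 n2 n3 \<and> (S l = (\<lambda>i j k. 0) \<or> slice_rank_one n1 n2 n3 (S l))"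
  shows "\<exists>r'\<le>r. slice_decomposition n1 n2 n3 (\<lambda>i j k. \<Sum>l<r. S l i j k) r'"
  using assms
proof (induction r)
  case 0
  then show ?case by (auto simp: slice_decomposition_def)
next
  case (Suc r)
  then obtain r' S' where r': "r' \<le> r"
    and S': "\<forall>l<r'. S' l \<in> tensor_space n1 n2 n3 \<and> slice_rank_one n1 n2 n3 (S' l)"
    and eq: "(\<lambda>i j k. \<Sum>l<r. S l i j k) = (\<lambda>i j k. \<Sum>l<r'. S' l i j k)"
    by (auto simp: slice_decomposition_def)
  have eq': "(\<Sum>l<r. S l i j k) = (\<Sum>l<r'. S' l i j k)" for i j k
    using eq by meson
  show ?case
  proof (cases "S r = (\<lambda>i j k. 0)")
    case True
    then show ?thesis using r' S' unfolding slice_decomposition_def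
      by (intro exI[of _ r'] conjI exI[of _ S']) (auto simp: eq')
  next
    case False
    then show ?thesis using r' S' Suc.prems unfolding slice_decomposition_def
      by (intro exI[of _ "Suc r'"] conjI exI[of _ "S'(r' := S r)"]) (auto simp: eq' less_Suc_eq)
  qed
qed

lemma slice_rank_eq_Least: "slice_rank n1 n2 n3 T = (LEAST r. slice_decomposition n1 n2 n3 T r)"
  unfolding slice_rank_def slice_decomposition_def ..

lemma slice_sum_imp_slice_decomposition:
  assumes T: "T \<in> tensor_space n1 n2 n3" and "slice_sum n1 n2 n3 T s"
  shows "\<exists>r\<le>s. slice_decomposition n1 n2 n3 T r"
proof -
  obtain r1 r2 r3 f1 g1 f2 g2 f3 g3 where r: "r1 + r2 + r3 \<le> s"
    and eq: "\<forall>i<n1. \<forall>j<n2. \<forall>k<n3. T i j k =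
        (\<Sum>l<r1. f1 l i * g1 l j k) + (\<Sum>l<r2. f2 l j * g2 l i k) + (\<Sum>l<r3. f3 l k * g3 l i j)"
    using assms(2) unfolding slice_sum_def by (elim exE conjE)
  \<comment> \<open>The nesting of the conditionals mirrors two uses of
    \<open>sum_lessThan_append\<close>; the outer one cuts each term off at the box, as
    \<open>tensor_space\<close> demands.\<close>
  define S where "S = (\<lambda>l i j k. if i < n1 \<and> j < n2 \<and> k < n3 then
     (if l < r1 + r2 then if l < r1 then f1 l i * g1 l j k else f2 (l - r1) j * g2 (l - r1) i k
      else f3 (l - (r1 + r2)) k * g3 (l - (r1 + r2)) i j) else 0)"
  have Sl: "S l \<in> tensor_space n1 n2 n3" for l by (auto simp: S_def tensor_space_def)
  have "S l = (\<lambda>i j k. 0) \<or> slice_rank_one n1 n2 n3 (S l)" for l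
  proof (cases "S l = (\<lambda>i j k. 0)")
    case False
    consider "l < r1" | "r1 \<le> l" "l < r1 + r2" | "r1 + r2 \<le> l" by linarith
    then have "slice_rank_one n1 n2 n3 (S l)"
    proof cases
      case 1
      then have *: "\<forall>i<n1. \<forall>j<n2. \<forall>k<n3. S l i j k = f1 l i * g1 l j k" by (simp add: S_def)
      show ?thesis
        by (rule outer_imp_slice_rank_one[OF Sl False, where f = "f1 l" and g = "g1 l"]) (use * in blast)
    next
      case 2
      then have *: "\<forall>i<n1. \<forall>j<n2. \<forall>k<n3. S l i j k = f2 (l - r1) j * g2 (l - r1) i k" by (simp add: S_def)
      show ?thesis
        by (rule outer_imp_slice_rank_one[OF Sl False, where f = "f2 (l - r1)" and g = "g2 (l - r1)"])
          (use * in blast)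
    next
      case 3
      then have *: "\<forall>i<n1. \<forall>j<n2. \<forall>k<n3. S l i j k = f3 (l - (r1 + r2)) k * g3 (l - (r1 + r2)) i j"
        by (simp add: S_def)
      show ?thesis
        by (rule outer_imp_slice_rank_one[OF Sl False,
              where f = "f3 (l - (r1 + r2))" and g = "g3 (l - (r1 + r2))"])
          (use * in blast)
    qed
    then show ?thesis ..
  qed auto
  with Sl have "\<exists>r'\<le>r1 + r2 + r3. slice_decomposition n1 n2 n3 (\<lambda>i j k. \<Sum>l<r1 + r2 + r3. S l i j k) r'"
    by (intro slice_decomposition_drop_zero) auto
  moreover have "(\<lambda>i j k. \<Sum>l<r1 + r2 + r3. S l i j k) = T"
  proof (intro ext)
    fix i j k
    show "(\<Sum>l<r1 + r2 + r3. S l i j k) = T i j k"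
    proof (cases "i < n1 \<and> j < n2 \<and> k < n3")
      case True
      then show ?thesis using eq by (simp add: S_def sum_lessThan_append)
    next
      case False
      then show ?thesis using T by (auto simp: S_def tensor_space_def)
    qed
  qed
  ultimately show ?thesis using r by (metis order_trans)
qed

lemma slice_rank_le_slice_sum:
  assumes "T \<in> tensor_space n1 n2 n3" "slice_sum n1 n2 n3 T s"
  shows "slice_rank n1 n2 n3 T \<le> s"
  unfolding slice_rank_eq_Least
  using slice_sum_imp_slice_decomposition[OF assms] by (meson Least_le order_trans)

lemma slice_rank_le: "T \<in> tensor_space n1 n2 n3 \<Longrightarrow> slice_rank n1 n2 n3 T \<le> n1"
  by (rule slice_rank_le_slice_sum[OF _ slice_sum_first_leg])

lemma slice_sum_slice_rank:
  assumes "T \<in> tensor_space n1 n2 n3"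
  shows "slice_sum n1 n2 n3 T (slice_rank n1 n2 n3 T)"
proof -
  have *: "slice_sum n1 n2 n3 (\<lambda>i j k. \<Sum>l<r. S l i j k) r"
    if "\<forall>l<r. slice_rank_one n1 n2 n3 (S l)" for S :: "nat \<Rightarrow> 'a tensor3" and r
    using that
  proof (induction r)
    case 0
    show ?case by (rule slice_sumI[where ?r1.0 = 0 and ?r2.0 = 0 and ?r3.0 = 0]) auto
  next
    case (Suc r)
    then show ?case
      using slice_sum_add[OF Suc.IH slice_rank_one_imp_slice_sum[of n1 n2 n3 "S r"]] by simp
  qed
  obtain r where "slice_decomposition n1 n2 n3 T r"
    using slice_sum_imp_slice_decomposition[OF assms slice_sum_first_leg] by blast
  then have "slice_decomposition n1 n2 n3 T (slice_rank n1 n2 n3 T)"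
    unfolding slice_rank_eq_Least by (rule LeastI)
  then show ?thesis using * unfolding slice_decomposition_def by metis
qed

lemma sum_box_separate:
  fixes X Y Z f :: "nat \<Rightarrow> 'a::comm_ring_1"
  shows "(\<Sum>(i, j, k)\<in>box n1 n2 n3. X i * Y j * Z k * (f i * g j k))
      = (\<Sum>i<n1. X i * f i) * (\<Sum>j<n2. \<Sum>k<n3. Y j * Z k * g j k)" (is ?first)
    and "(\<Sum>(i, j, k)\<in>box n1 n2 n3. X i * Y j * Z k * (f j * g i k))
      = (\<Sum>j<n2. Y j * f j) * (\<Sum>i<n1. \<Sum>k<n3. X i * Z k * g i k)" (is ?second)
    and "(\<Sum>(i, j, k)\<in>box n1 n2 n3. X i * Y j * Z k * (f k * g i j))
      = (\<Sum>k<n3. Z k * f k) * (\<Sum>i<n1. \<Sum>j<n2. X i * Y j * g i j)" (is ?third)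
proof -
  show ?first
    unfolding sum_box sum_product by (intro sum.cong refl) (simp add: sum_distrib_left mult_ac)
  show ?second
    unfolding sum_box sum_product
    by (subst sum.swap, intro sum.cong refl) (simp add: sum_distrib_left mult_ac)
  show ?third
    unfolding sum_box
    by (subst mult.commute[of "\<Sum>k<n3. Z k * f k"], unfold sum_distrib_right, intro sum.cong refl)
      (simp add: sum_distrib_left mult_ac)
qed

text \<open>Linear maps send a vector on one leg times a matrix on the other two to a product of the
  same kind, so the terms are transported one by one.\<close>

lemma slice_sum_restricts:
  assumes "restricts_to (n1, n2, n3) T (p1, p2, p3) S" "slice_sum n1 n2 n3 T s"
  shows "slice_sum p1 p2 p3 S s"
proof -
  obtain X Y Z where S: "\<forall>a<p1. \<forall>b<p2. \<forall>c<p3.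
      S a b c = (\<Sum>(i, j, k)\<in>box n1 n2 n3. X a i * Y b j * Z c k * T i j k)"
    using assms(1) unfolding restricts_to_def by auto
  obtain r1 r2 r3 f1 g1 f2 g2 f3 g3 where r: "r1 + r2 + r3 \<le> s"
    and T: "\<forall>i<n1. \<forall>j<n2. \<forall>k<n3. T i j k =
        (\<Sum>l<r1. f1 l i * g1 l j k) + (\<Sum>l<r2. f2 l j * g2 l i k) + (\<Sum>l<r3. f3 l k * g3 l i j)"
    using assms(2) unfolding slice_sum_def by (elim exE conjE)
  show ?thesis
  proof (rule slice_sumI[OF r, where
        ?f1.0 = "\<lambda>l a. \<Sum>i<n1. X a i * f1 l i" and
        ?g1.0 = "\<lambda>l b c. \<Sum>j<n2. \<Sum>k<n3. Y b j * Z c k * g1 l j k" and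
        ?f2.0 = "\<lambda>l b. \<Sum>j<n2. Y b j * f2 l j" and
        ?g2.0 = "\<lambda>l a c. \<Sum>i<n1. \<Sum>k<n3. X a i * Z c k * g2 l i k" and
        ?f3.0 = "\<lambda>l c. \<Sum>k<n3. Z c k * f3 l k" and
        ?g3.0 = "\<lambda>l a b. \<Sum>i<n1. \<Sum>j<n2. X a i * Y b j * g3 l i j"])
    fix a b c assume *: "a < p1" "b < p2" "c < p3"
    have "S a b c = (\<Sum>(i, j, k)\<in>box n1 n2 n3. X a i * Y b j * Z c k *
        ((\<Sum>l<r1. f1 l i * g1 l j k) + (\<Sum>l<r2. f2 l j * g2 l i k) + (\<Sum>l<r3. f3 l k * g3 l i j)))"
      unfolding S[rule_format, OF *] by (intro sum.cong) (auto simp: box_def T)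
    also have "\<dots> = (\<Sum>l<r1. \<Sum>(i, j, k)\<in>box n1 n2 n3. X a i * Y b j * Z c k * (f1 l i * g1 l j k))
        + (\<Sum>l<r2. \<Sum>(i, j, k)\<in>box n1 n2 n3. X a i * Y b j * Z c k * (f2 l j * g2 l i k))
        + (\<Sum>l<r3. \<Sum>(i, j, k)\<in>box n1 n2 n3. X a i * Y b j * Z c k * (f3 l k * g3 l i j))"
      unfolding case_prod_unfold distrib_left sum.distrib sum_distrib_left
      by (intro arg_cong2[where f = "(+)"] sum.swap)
    finally show "S a b c = (\<Sum>l<r1. (\<Sum>i<n1. X a i * f1 l i) * (\<Sum>j<n2. \<Sum>k<n3. Y b j * Z c k * g1 l j k)) +
       (\<Sum>l<r2. (\<Sum>j<n2. Y b j * f2 l j) * (\<Sum>i<n1. \<Sum>k<n3. X a i * Z c k * g2 l i k)) +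
       (\<Sum>l<r3. (\<Sum>k<n3. Z c k * f3 l k) * (\<Sum>i<n1. \<Sum>j<n2. X a i * Y b j * g3 l i j))"
      unfolding sum_box_separate .
  qed
qed

text \<open>Tao's argument: a vector orthogonal to all first-leg factors and of maximal support turns the
  unit tensor into a diagonal matrix of rank at least \<open>r - r1\<close>.\<close>

lemma slice_sum_unit_tensor_ge:
  assumes "slice_sum r r r (unit_tensor r :: 'a::field tensor3) s"
  shows "r \<le> s"
proof -
  obtain r1 r2 r3 and f1 f2 f3 :: "nat \<Rightarrow> nat \<Rightarrow> 'a" and g1 g2 g3 where s: "r1 + r2 + r3 \<le> s"
    and T: "\<forall>i<r. \<forall>j<r. \<forall>k<r. unit_tensor r i j k =
        (\<Sum>l<r1. f1 l i * g1 l j k) + (\<Sum>l<r2. f2 l j * g2 l i k) + (\<Sum>l<r3. f3 l k * g3 l i j)"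
    using assms unfolding slice_sum_def by (elim exE conjE)
  define orth where "orth v \<longleftrightarrow> (\<forall>l<r1. (\<Sum>i<r. v i * f1 l i) = 0)" for v
  define supp where "supp v = {i. i < r \<and> v i \<noteq> (0 :: 'a)}" for v
  have fin: "finite (supp v)" for v by (simp add: supp_def)
  define good where "good n \<longleftrightarrow> (\<exists>v. orth v \<and> card (supp v) = n)" for n
  have good_le: "n \<le> r" if "good n" for n
  proof -
    obtain v where "card (supp v) = n" using \<open>good n\<close> by (auto simp: good_def)
    moreover have "card (supp v) \<le> card {..<r}" by (intro card_mono) (auto simp: supp_def)
    ultimately show ?thesis by simp
  qed
  have "good 0" unfolding good_def by (rule exI[of _ "\<lambda>_. 0"]) (simp add: orth_def supp_def)
  then have "good (GREATEST n. good n)" using good_le by (rule GreatestI_nat)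
  then obtain v where v: "orth v" "card (supp v) = (GREATEST n. good n)" unfolding good_def by blast
  have max: "card (supp w) \<le> card (supp v)" if "orth w" for w
    unfolding v(2) by (rule Greatest_le_nat[OF _ good_le]) (use that in \<open>auto simp: good_def\<close>)
  \<comment> \<open>Otherwise the indices off the support outnumber the \<open>r1\<close> equations
    and carry a nonzero solution; adding it to \<open>v\<close> keeps orthogonality and enlarges the
    support.\<close>
  have big: "r \<le> r1 + card (supp v)"
  proof (rule ccontr)
    assume "\<not> ?thesis"
    moreover have "card ({..<r} - supp v) = r - card (supp v)"
      using fin by (subst card_Diff_subset) (auto simp: supp_def)
    ultimately have "card {..<r1} < card ({..<r} - supp v)" by simp
    from underdetermined_system[OF _ _ this, of "\<lambda>i l. f1 l i"]
    obtain c where c: "\<exists>i\<in>{..<r} - supp v. c i \<noteq> 0"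
      "\<forall>l\<in>{..<r1}. (\<Sum>i\<in>{..<r} - supp v. c i * f1 l i) = 0" by auto
    define w where "w i = (if i \<in> supp v then v i else c i)" for i
    have "(\<Sum>i<r. w i * f1 l i) = 0" if "l < r1" for l
    proof -
      have "(\<Sum>i<r. w i * f1 l i) = (\<Sum>i\<in>{..<r} - supp v. w i * f1 l i) + (\<Sum>i\<in>supp v. w i * f1 l i)"
        by (rule sum.subset_diff) (auto simp: supp_def)
      also have "(\<Sum>i\<in>{..<r} - supp v. w i * f1 l i) = 0"
        using c(2) that by (simp add: w_def)
      also have "(\<Sum>i\<in>supp v. w i * f1 l i) = (\<Sum>i<r. v i * f1 l i)"
        by (rule sum.mono_neutral_cong_left) (auto simp: supp_def w_def)
      also have "\<dots> = 0" using v(1) that by (simp add: orth_def)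
      finally show ?thesis by simp
    qed
    then have "orth w" by (simp add: orth_def)
    moreover have "supp v \<subset> supp w" using c(1) by (auto simp: w_def supp_def)
    then have "card (supp v) < card (supp w)" by (rule psubset_card_mono[OF fin])
    ultimately show False using max by fastforce
  qed
  \<comment> \<open>After contraction with \<open>v\<close> the first family is gone, and the
    remaining \<open>r2 + r3\<close> terms factor the diagonal matrix with entries
    \<open>v j\<close>.\<close>
  define L where "L = {..<r2} <+> {..<r3}"
  have "card (supp v) \<le> card L"
  proof (rule diagonal_factor_card_le[where d = v
        and P = "\<lambda>j. case_sum (\<lambda>l. f2 l j) (\<lambda>l. \<Sum>i<r. v i * g3 l i j)"
        and Q = "case_sum (\<lambda>l k. \<Sum>i<r. v i * g2 l i k) f3"])
    fix j k assume jk: "j \<in> supp v" "k \<in> supp v"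
    then have jk': "j < r" "k < r" by (auto simp: supp_def)
    have "(\<Sum>i<r. v i * unit_tensor r i j k) = (\<Sum>i<r. if i = j then (if j = k then v j else 0) else 0)"
      using jk' by (intro sum.cong) (auto simp: unit_tensor_def)
    then have "(if j = k then v j else 0) = (\<Sum>i<r. v i * unit_tensor r i j k)" using jk' by simp
    also have "\<dots> = (\<Sum>i<r. (\<Sum>l<r1. v i * f1 l i * g1 l j k) + (\<Sum>l<r2. f2 l j * (v i * g2 l i k))
        + (\<Sum>l<r3. v i * g3 l i j * f3 l k))"
      using T jk' by (intro sum.cong) (auto simp: algebra_simps sum_distrib_left)
    also have "\<dots> = (\<Sum>l<r1. (\<Sum>i<r. v i * f1 l i) * g1 l j k) + (\<Sum>l<r2. f2 l j * (\<Sum>i<r. v i * g2 l i k))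
        + (\<Sum>l<r3. (\<Sum>i<r. v i * g3 l i j) * f3 l k)"
      unfolding sum.distrib sum_distrib_left sum_distrib_right
      by (intro arg_cong2[where f = "(+)"] sum.swap)
    also have "(\<Sum>l<r1. (\<Sum>i<r. v i * f1 l i) * g1 l j k) = 0" using v(1) by (simp add: orth_def)
    finally show "(\<Sum>l\<in>L. case_sum (\<lambda>l. f2 l j) (\<lambda>l. \<Sum>i<r. v i * g3 l i j) l *
        case_sum (\<lambda>l k. \<Sum>i<r. v i * g2 l i k) f3 l k) = (if j = k then v j else 0)"
      unfolding L_def by (subst sum.Plus) auto
  qed (auto simp: L_def supp_def)
  then show ?thesis using big s by (simp add: L_def card_Plus)
qed

lemma subrank_le_slice_rank:
  assumes "T \<in> tensor_space n1 n2 n3"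
  shows "subrank n1 n2 n3 T \<le> slice_rank n1 n2 n3 T"
  by (rule slice_sum_unit_tensor_ge[OF slice_sum_restricts[OF restricts_to_subrank slice_sum_slice_rank[OF assms]]])

section \<open>Slices along one leg: covering them and contracting to an identity matrix\<close>

definition slice_form :: "nat \<Rightarrow> nat \<Rightarrow> nat \<Rightarrow> ('a::field) tensor3 \<Rightarrow> (nat \<Rightarrow> 'a) \<Rightarrow> 'a form" where
  "slice_form n1 n2 n3 T u x y = (\<Sum>(i, j, k)\<in>box n1 n2 n3. u i * x j * y k * T i j k)"

lemma bilinear_slice_form: "bilinear_form (slice_form n1 n2 n3 T u)"
  unfolding bilinear_form_def slice_form_def sum_distrib_left case_prod_unfold sum.distrib[symmetric]
  by (auto simp: algebra_simps)

lemma rank_bound_slice_form: "rank_bound (slice_form n1 n2 n3 T u) n2"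
  unfolding rank_bound_def
proof (intro allI impI)
  fix t X Y assume dual: "dual_system (slice_form n1 n2 n3 T u) t X Y"
  have "card {..<t} \<le> card {..<n2}"
  proof (rule diagonal_factor_card_le[where d = "\<lambda>_. 1" and P = X
        and Q = "\<lambda>j b. \<Sum>i<n1. \<Sum>k<n3. u i * Y b k * T i j k"])
    fix a b assume "a \<in> {..<t}" "b \<in> {..<t}"
    then have "(if a = b then 1 else 0) = slice_form n1 n2 n3 T u (X a) (Y b)"
      using dual_systemD[OF dual] by simp
    also have "\<dots> = (\<Sum>j<n2. X a j * (\<Sum>i<n1. \<Sum>k<n3. u i * Y b k * T i j k))"
      unfolding slice_form_def sum_box by (subst sum.swap) (simp add: sum_distrib_left mult_ac)
    finally show "(\<Sum>j<n2. X a j * (\<Sum>i<n1. \<Sum>k<n3. u i * Y b k * T i j k)) = (if a = b then 1 else 0)" ..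
  qed auto
  then show "t \<le> n2" by simp
qed

text \<open>It is essential that one number \<open>q\<close> serves both conclusions: a combination
  of slices attaining the maximal rank contracts \<open>T\<close> to an identity of size
  \<open>q\<close>, and the covering of all combinations is measured by the same maximum.\<close>

lemma slice_space_max_rank:
  fixes T :: "'a::field tensor3"
  shows "\<exists>(q :: nat) (s :: nat) u X Y f g f' g'.
    (\<forall>b<q. \<forall>c<q. (\<Sum>(i, j, k)\<in>box n1 n2 n3. u i * X b j * Y c k * T i j k) = of_bool (b = c)) \<and>
    s \<le> 2 * q \<and>
    (\<forall>i<n1. \<forall>j<n2. \<forall>k<n3. T i j k = (\<Sum>l<s. f l j * g l i k) + (\<Sum>l<s. f' l k * g' l i j))"
proof -
  let ?F = "slice_form n1 n2 n3 T"
  have space: "form_space (range ?F)"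
    unfolding form_space_def
  proof (intro conjI ballI)
    fix M N assume "M \<in> range ?F" "N \<in> range ?F"
    then obtain u v where *: "M = ?F u" "N = ?F v" by auto
    have "(\<lambda>x y. M x y + N x y) = ?F (\<lambda>i. u i + v i)"
      unfolding * slice_form_def case_prod_unfold sum.distrib[symmetric] by (simp add: algebra_simps)
    then show "(\<lambda>x y. M x y + N x y) \<in> range ?F" by simp
  qed (auto simp: bilinear_slice_form)
  obtain q where q: "max_rank (range ?F) q"
    using max_rank_exists[of "?F (\<lambda>_. 0)" "range ?F" n2] rank_bound_slice_form by blast
  then obtain u X Y where "dual_system (?F u) q X Y" unfolding max_rank_def by auto
  then have dual: "\<forall>b<q. \<forall>c<q. (\<Sum>(i, j, k)\<in>box n1 n2 n3. u i * X b j * Y c k * T i j k) = of_bool (b = c)"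
    by (simp add: dual_system_def slice_form_def of_bool_def)
  obtain s f g f' g' where s: "s \<le> 2 * q" and dec: "\<forall>M\<in>range ?F. \<forall>x y.
      M x y = (\<Sum>l<s. f l x * g M l y) + (\<Sum>l<s. g' M l x * f' l y)"
    using max_rank_decomposition[OF space q] by (elim exE conjE)
  \<comment> \<open>Evaluation at unit vectors reads off the entries of \<open>T\<close>: the common
    functionals \<open>f\<close> become vectors on the second leg, \<open>f'\<close> vectors on the
    third.\<close>
  define e where "e = (\<lambda>(i :: nat) i'. of_bool (i' = i) :: 'a)"
  have dec': "T i j k = (\<Sum>l<s. f l (e j) * g (?F (e i)) l (e k)) + (\<Sum>l<s. f' l (e k) * g' (?F (e i)) l (e j))"
    if "i < n1" "j < n2" "k < n3" for i j k
  proof -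
    have "T i j k = ?F (e i) (e j) (e k)"
      unfolding slice_form_def e_def sum_box_pick[OF that] ..
    also have "\<dots> = (\<Sum>l<s. f l (e j) * g (?F (e i)) l (e k)) + (\<Sum>l<s. g' (?F (e i)) l (e j) * f' l (e k))"
      using dec by blast
    finally show ?thesis by (simp only: mult.commute[of "f' _ _"])
  qed
  show ?thesis
    by (intro exI[of _ q] exI[of _ s] exI[of _ u] exI[of _ X] exI[of _ Y]
        exI[of _ "\<lambda>l j. f l (e j)"] exI[of _ "\<lambda>l i k. g (?F (e i)) l (e k)"]
        exI[of _ "\<lambda>l k. f' l (e k)"] exI[of _ "\<lambda>l i j. g' (?F (e i)) l (e j)"] conjI dual s)
      (intro allI impI, rule dec')
qed

lemma slice_sum_restricts_leg1:
  fixes T :: "'a::field tensor3"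
  shows "\<exists>q. slice_sum n1 n2 n3 T (4 * q) \<and>
    restricts_to (n1, n2, n3) T (1, q, q) (\<lambda>a b c. of_bool (b = c))"
proof -
  obtain q s :: nat and u X Y f g f' g' where
    *: "\<forall>b<q. \<forall>c<q. (\<Sum>(i, j, k)\<in>box n1 n2 n3. u i * X b j * Y c k * T i j k) = of_bool (b = c)"
    and s: "s \<le> 2 * q"
    and dec: "\<forall>i<n1. \<forall>j<n2. \<forall>k<n3. T i j k = (\<Sum>l<s. f l j * g l i k) + (\<Sum>l<s. f' l k * g' l i j)"
    using slice_space_max_rank[where ?n1.0 = n1 and ?n2.0 = n2 and ?n3.0 = n3 and T = T]
    by (elim exE conjE)
  have "slice_sum n1 n2 n3 T (4 * q)"
    by (rule slice_sumI[where ?r1.0 = 0 and ?r2.0 = s and ?r3.0 = s and ?f2.0 = f and ?g2.0 = g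
          and ?f3.0 = f' and ?g3.0 = g']) (use s dec in auto)
  moreover have "restricts_to (n1, n2, n3) T (1, q, q) (\<lambda>a b c. of_bool (b = c))"
    by (rule restricts_toI[where X = "\<lambda>_. u" and Y = X and Z = Y]) (use * in simp)
  ultimately show ?thesis by blast
qed

text \<open>\<open>slice_space_max_rank\<close> singles out its first leg, so the second leg is
  moved to the front and the order of the sums restored afterwards.\<close>

lemma slice_sum_restricts_leg2:
  fixes T :: "'a::field tensor3"
  shows "\<exists>q. slice_sum n1 n2 n3 T (4 * q) \<and>
    restricts_to (n1, n2, n3) T (q, 1, q) (\<lambda>a b c. of_bool (a = c))"
proof -
  obtain q s :: nat and u X Y f g f' g' where
    *: "\<forall>b<q. \<forall>c<q. (\<Sum>(j, i, k)\<in>box n2 n1 n3. u j * X b i * Y c k * T i j k) = of_bool (b = c)"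
    and s: "s \<le> 2 * q"
    and dec: "\<forall>j<n2. \<forall>i<n1. \<forall>k<n3. T i j k = (\<Sum>l<s. f l i * g l j k) + (\<Sum>l<s. f' l k * g' l j i)"
    using slice_space_max_rank[where ?n1.0 = n2 and ?n2.0 = n1 and ?n3.0 = n3 and T = "\<lambda>j i k. T i j k"]
    by (elim exE conjE)
  have "slice_sum n1 n2 n3 T (4 * q)"
    by (rule slice_sumI[where ?r1.0 = s and ?r2.0 = 0 and ?r3.0 = s and ?f1.0 = f and ?g1.0 = g
          and ?f3.0 = f' and ?g3.0 = "\<lambda>l i j. g' l j i"]) (use s dec in auto)
  moreover have "restricts_to (n1, n2, n3) T (q, 1, q) (\<lambda>a b c. of_bool (a = c))"
  proof (rule restricts_toI[where X = X and Y = "\<lambda>_. u" and Z = Y])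
    fix a b c assume "a < q" "c < q"
    then have "of_bool (a = c) = (\<Sum>j<n2. \<Sum>i<n1. \<Sum>k<n3. u j * X a i * Y c k * T i j k)"
      using * by (simp add: sum_box)
    also have "\<dots> = (\<Sum>i<n1. \<Sum>j<n2. \<Sum>k<n3. X a i * u j * Y c k * T i j k)"
      by (subst sum.swap) (simp add: mult_ac)
    finally show "of_bool (a = c) = (\<Sum>(i, j, k)\<in>box n1 n2 n3. X a i * u j * Y c k * T i j k)"
      by (simp add: sum_box)
  qed
  ultimately show ?thesis by blast
qed

lemma slice_sum_restricts_leg3:
  fixes T :: "'a::field tensor3"
  shows "\<exists>q. slice_sum n1 n2 n3 T (4 * q) \<and>
    restricts_to (n1, n2, n3) T (q, q, 1) (\<lambda>a b c. of_bool (a = b))"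
proof -
  obtain q s :: nat and u X Y f g f' g' where
    *: "\<forall>b<q. \<forall>c<q. (\<Sum>(k, i, j)\<in>box n3 n1 n2. u k * X b i * Y c j * T i j k) = of_bool (b = c)"
    and s: "s \<le> 2 * q"
    and dec: "\<forall>k<n3. \<forall>i<n1. \<forall>j<n2. T i j k = (\<Sum>l<s. f l i * g l k j) + (\<Sum>l<s. f' l j * g' l k i)"
    using slice_space_max_rank[where ?n1.0 = n3 and ?n2.0 = n1 and ?n3.0 = n2 and T = "\<lambda>k i j. T i j k"]
    by (elim exE conjE)
  have "slice_sum n1 n2 n3 T (4 * q)"
    by (rule slice_sumI[where ?r1.0 = s and ?r2.0 = s and ?r3.0 = 0 and ?f1.0 = f and ?g1.0 = "\<lambda>l j k. g l k j"
          and ?f2.0 = f' and ?g2.0 = "\<lambda>l i k. g' l k i"]) (use s dec in auto)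
  moreover have "restricts_to (n1, n2, n3) T (q, q, 1) (\<lambda>a b c. of_bool (a = b))"
  proof (rule restricts_toI[where X = X and Y = Y and Z = "\<lambda>_. u"])
    fix a b c assume "a < q" "b < q"
    then have "of_bool (a = b) = (\<Sum>k<n3. \<Sum>i<n1. \<Sum>j<n2. u k * X a i * Y b j * T i j k)"
      using * by (simp add: sum_box)
    also have "\<dots> = (\<Sum>i<n1. \<Sum>k<n3. \<Sum>j<n2. X a i * Y b j * u k * T i j k)"
      by (subst sum.swap) (simp add: mult_ac)
    also have "\<dots> = (\<Sum>i<n1. \<Sum>j<n2. \<Sum>k<n3. X a i * Y b j * u k * T i j k)"
      by (rule sum.cong[OF refl], rule sum.swap)
    finally show "of_bool (a = b) = (\<Sum>(i, j, k)\<in>box n1 n2 n3. X a i * Y b j * u k * T i j k)"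
      by (simp add: sum_box)
  qed
  ultimately show ?thesis by blast
qed

section \<open>Asymptotic subrank of matrix multiplication\<close>

text \<open>Horner scheme with the newest letter as least significant digit, because
  \<open>kronecker_power\<close> attaches each new factor on the right.\<close>

primrec encode :: "nat \<Rightarrow> (nat \<Rightarrow> nat) \<Rightarrow> nat \<Rightarrow> nat" where
  "encode n f 0 = 0"
| "encode n f (Suc m) = encode n f m * n + f m"

lemma encode_less: "(\<And>t. t < m \<Longrightarrow> f t < n) \<Longrightarrow> encode n f m < n ^ m"
proof (induction m)
  case (Suc m)
  then have "encode n f m * n + f m < n ^ m * n" by (intro pair_index_less) auto
  then show ?case by (simp add: mult.commute)
qed simp

lemma kronecker_power_encode:
  assumes "\<And>t. t < m \<Longrightarrow> f t < n1 \<and> g t < n2 \<and> h t < n3"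
  shows "kronecker_power n1 n2 n3 T m (encode n1 f m) (encode n2 g m) (encode n3 h m)
    = (\<Prod>t<m. T (f t) (g t) (h t))"
  using assms
proof (induction m)
  case 0
  then show ?case by (simp add: unit_tensor_def)
next
  case (Suc m)
  have lt: "f m < n1" "g m < n2" "h m < n3" using Suc.prems[of m] by auto
  then have "0 < n1" "0 < n2" "0 < n3" by auto
  with lt show ?case using Suc by (simp add: kronecker_def)
qed

text \<open>Combinatorial degeneration. The weights are additive along a Kronecker power, so among the
  words in \<open>\<Phi>\<close> with prescribed total weights every nonzero entry has total weight zero in each
  letter, which leaves only the diagonal.\<close>

lemma subrank_power_degeneration:
  fixes W :: "'a::field tensor3" and \<Phi> :: "'e set" and \<alpha> \<beta> \<gamma> :: "'e \<Rightarrow> int"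
  assumes fin: "finite \<Phi>"
    and range: "\<And>e. e \<in> \<Phi> \<Longrightarrow> x e < p1 \<and> y e < p2 \<and> z e < p3"
    and one: "\<And>e. e \<in> \<Phi> \<Longrightarrow> W (x e) (y e) (z e) = 1"
    and zero_weight: "\<And>e. e \<in> \<Phi> \<Longrightarrow> \<alpha> e + \<beta> e + \<gamma> e = 0"
    and nonneg: "\<And>e e' e''. e \<in> \<Phi> \<Longrightarrow> e' \<in> \<Phi> \<Longrightarrow> e'' \<in> \<Phi> \<Longrightarrow> W (x e) (y e') (z e'') \<noteq> 0 \<Longrightarrow>
      \<alpha> e + \<beta> e' + \<gamma> e'' \<ge> 0"
    and diag: "\<And>e e' e''. e \<in> \<Phi> \<Longrightarrow> e' \<in> \<Phi> \<Longrightarrow> e'' \<in> \<Phi> \<Longrightarrow> W (x e) (y e') (z e'') \<noteq> 0 \<Longrightarrow>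
      \<alpha> e + \<beta> e' + \<gamma> e'' = 0 \<Longrightarrow> e = e' \<and> e' = e''"
    and bound: "\<And>e. e \<in> \<Phi> \<Longrightarrow> \<bar>\<alpha> e\<bar> \<le> int B \<and> \<bar>\<beta> e\<bar> \<le> int B"
  shows "card \<Phi> ^ m \<le> (2 * m * B + 1)\<^sup>2 * subrank (p1 ^ m) (p2 ^ m) (p3 ^ m) (kronecker_power p1 p2 p3 W m)"
proof -
  define D where "D = PiE {..<m} (\<lambda>_. \<Phi>)"
  \<comment> \<open>Fixing the totals of \<alpha> and \<beta> fixes that of \<gamma>, since the
    three weights of a letter add up to zero.\<close>
  define key where "key e = ((\<Sum>t<m. \<alpha> (e t)), (\<Sum>t<m. \<beta> (e t)))" for e
  define K where "K = {- int (m * B)..int (m * B)} \<times> {- int (m * B)..int (m * B)}"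
  let ?s = "subrank (p1 ^ m) (p2 ^ m) (p3 ^ m) (kronecker_power p1 p2 p3 W m)"
  have finD: "finite D" unfolding D_def by (intro finite_PiE fin) auto
  have cardD: "card D = card \<Phi> ^ m" by (simp add: D_def card_PiE)
  have D: "e t \<in> \<Phi>" if "e \<in> D" "t < m" for e t
    using that by (auto simp: D_def PiE_iff)
  \<comment> \<open>Selecting on the three legs the basis vectors of all words with a common key
    restricts the power to a unit tensor of that size.\<close>
  have fibre: "card {e \<in> D. key e = \<kappa>} \<le> ?s" for \<kappa>
  proof -
    let ?A = "{e \<in> D. key e = \<kappa>}"
    have "finite ?A" using finD by simp
    then obtain h where h: "bij_betw h {..<card ?A} ?A"
      using ex_bij_betw_nat_finite[of ?A] by (auto simp: atLeast0LessThan)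
    have hA: "h a \<in> D" "key (h a) = \<kappa>" if "a < card ?A" for a
      using bij_betwE[OF h] that by auto
    have entry: "(\<Prod>t<m. W (x (e t)) (y (e' t)) (z (e'' t))) = of_bool (e = e' \<and> e' = e'')"
      if e: "e \<in> D" "e' \<in> D" "e'' \<in> D" and k: "key e = \<kappa>" "key e' = \<kappa>" "key e'' = \<kappa>" for e e' e''
    proof (cases "e = e' \<and> e' = e''")
      case True
      then show ?thesis using one D e by simp
    next
      case False
      have "(\<Prod>t<m. W (x (e t)) (y (e' t)) (z (e'' t))) = 0"
      proof (rule ccontr)
        assume "\<not> ?thesis"
        then have nz: "W (x (e t)) (y (e' t)) (z (e'' t)) \<noteq> 0" if "t < m" for t
          using that by simp
        \<comment> \<open>The common key lets \<open>e''\<close> replace \<open>e\<close> and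
          \<open>e'\<close> in the totals, so the total weight is zero; being nonnegative, the
          weights of the letters then vanish one by one.\<close>
        have "(\<Sum>t<m. \<alpha> (e t) + \<beta> (e' t) + \<gamma> (e'' t))
            = (\<Sum>t<m. \<alpha> (e'' t)) + (\<Sum>t<m. \<beta> (e'' t)) + (\<Sum>t<m. \<gamma> (e'' t))"
          using k by (auto simp: key_def sum.distrib)
        also have "\<dots> = (\<Sum>t<m. \<alpha> (e'' t) + \<beta> (e'' t) + \<gamma> (e'' t))" by (simp add: sum.distrib)
        also have "\<dots> = 0" using zero_weight D e by simp
        finally have zero: "\<forall>t\<in>{..<m}. \<alpha> (e t) + \<beta> (e' t) + \<gamma> (e'' t) = 0"
          by (subst (asm) sum_nonneg_eq_0_iff) (use nonneg nz D e in auto)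
        have letters: "e t = e' t \<and> e' t = e'' t" if "t < m" for t
          by (rule diag) (use zero nz D e that in auto)
        have "e = e'"
          by (rule PiE_ext[OF e(1,2)[unfolded D_def]]) (use letters in auto)
        moreover have "e' = e''"
          by (rule PiE_ext[OF e(2,3)[unfolded D_def]]) (use letters in auto)
        ultimately show False using False by simp
      qed
      with False show ?thesis by (simp only: of_bool_eq)
    qed
    have inj: "h a = h b \<longleftrightarrow> a = b" if "a < card ?A" "b < card ?A" for a b
      using bij_betw_imp_inj_on[OF h] that by (auto simp: inj_on_def)
    have rng: "t < m \<Longrightarrow> x (h a t) < p1 \<and> y (h b t) < p2 \<and> z (h c t) < p3"
      if "a < card ?A" "b < card ?A" "c < card ?A" for a b c t
      using range D hA that by blast
    show ?thesis
    proof (rule le_subrank, rule restricts_toI[where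
          X = "\<lambda>a i. of_bool (i = encode p1 (\<lambda>t. x (h a t)) m)" and
          Y = "\<lambda>a i. of_bool (i = encode p2 (\<lambda>t. y (h a t)) m)" and
          Z = "\<lambda>a i. of_bool (i = encode p3 (\<lambda>t. z (h a t)) m)"])
      fix a b c assume *: "a < card ?A" "b < card ?A" "c < card ?A"
      have "unit_tensor (card ?A) a b c = (\<Prod>t<m. W (x (h a t)) (y (h b t)) (z (h c t)))"
        using * by (subst entry) (auto simp: hA inj unit_tensor_def)
      also have "\<dots> = kronecker_power p1 p2 p3 W m (encode p1 (\<lambda>t. x (h a t)) m)
          (encode p2 (\<lambda>t. y (h b t)) m) (encode p3 (\<lambda>t. z (h c t)) m)"
        using rng * by (subst kronecker_power_encode) auto
      finally show "unit_tensor (card ?A) a b c = (\<Sum>(i, j, k)\<in>box (p1 ^ m) (p2 ^ m) (p3 ^ m).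
           of_bool (i = encode p1 (\<lambda>t. x (h a t)) m) * of_bool (j = encode p2 (\<lambda>t. y (h b t)) m) *
           of_bool (k = encode p3 (\<lambda>t. z (h c t)) m) * kronecker_power p1 p2 p3 W m i j k)"
        by (subst sum_box_pick) (use rng * in \<open>auto intro!: encode_less\<close>)
    qed
  qed
  have abs_sum: "(\<Sum>t<m. f (e t)) \<in> {- int (m * B)..int (m * B)}"
    if "e \<in> D" "\<And>e. e \<in> \<Phi> \<Longrightarrow> \<bar>f e\<bar> \<le> int B" for e and f :: "'e \<Rightarrow> int"
  proof -
    have "\<bar>\<Sum>t<m. f (e t)\<bar> \<le> (\<Sum>t<m. \<bar>f (e t)\<bar>)" by (rule sum_abs)
    also have "\<dots> \<le> of_nat (card {..<m}) * int B"
      by (rule sum_bounded_above) (use that D in auto)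
    finally show ?thesis by auto
  qed
  have keyK: "key e \<in> K" if "e \<in> D" for e
    unfolding key_def K_def using abs_sum[OF that, of \<alpha>] abs_sum[OF that, of \<beta>] bound by blast
  \<comment> \<open>Pigeonhole: both totals lie in an interval of \<open>2 * m * B + 1\<close>
    integers, so some fibre loses only a polynomial factor.\<close>
  have "card D \<le> card (\<Union>\<kappa>\<in>K. {e \<in> D. key e = \<kappa>})"
    by (rule card_mono) (use keyK finD in \<open>auto simp: K_def\<close>)
  also have "\<dots> \<le> (\<Sum>\<kappa>\<in>K. card {e \<in> D. key e = \<kappa>})" by (rule card_UN_le) (simp add: K_def)
  also have "\<dots> \<le> of_nat (card K) * ?s" by (rule sum_bounded_above) (rule fibre)
  also have "card K = (2 * m * B + 1)\<^sup>2"
    by (simp add: K_def card_cartesian_product power2_eq_square nat_add_distrib nat_mult_distrib algebra_simps)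
  finally show ?thesis by (simp add: cardD)
qed

text \<open>Three identity matrices, placed on the leg pairs (2,3), (1,3) and (1,2). Starting from
  \<open>unit_tensor 1\<close> follows the recursion of \<open>kronecker_power\<close>, so a third
  power restricts to this product factor by factor.\<close>

definition matmul_tensor :: "nat \<Rightarrow> ('a::field) tensor3" where
  "matmul_tensor q = kronecker q q 1 (kronecker q 1 q (kronecker 1 q q (unit_tensor 1)
     (\<lambda>a b c. of_bool (b = c))) (\<lambda>a b c. of_bool (a = c))) (\<lambda>a b c. of_bool (a = b))"

lemma matmul_tensor_entry:
  assumes "u < q" "u' < q" "v < q" "v' < q" "w < q" "w' < q"
  shows "matmul_tensor q (v * q + w) (u * q + w') (u' * q + v') = of_bool (u = u' \<and> v = v' \<and> w = w')"
  using assms by (auto simp: matmul_tensor_def kronecker_def unit_tensor_def)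

lemma two_card_triangle: "q * q \<le> 2 * card (SIGMA u:{..<q}. {..<q - u})" for q :: nat
proof -
  have triangle: "q * (q + 1) = 2 * (\<Sum>u<q. q - u)" for q :: nat
  proof (induction q)
    case (Suc q)
    have "(\<Sum>u<Suc q. Suc q - u) = (\<Sum>u<q. q - u) + (q + 1)"
      by (subst sum.lessThan_Suc_shift) simp
    then show ?case using Suc by simp
  qed simp
  show ?thesis using triangle[of q] by simp
qed

text \<open>On the support of \<open>\<langle>q, q, q\<rangle>\<close>, indexed by \<open>(u, v, w)\<close>, the weights below add up to Strassen's
  \<open>(u + v - w)\<^sup>2\<close>.\<close>

lemma subrank_matmul_power:
  "(q * q) ^ m \<le> 2 ^ m * ((2 * m * (2 * q * q) + 1)\<^sup>2 *
     subrank ((q * q) ^ m) ((q * q) ^ m) ((q * q) ^ m)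
       (kronecker_power (q * q) (q * q) (q * q) (matmul_tensor q :: 'a::field tensor3) m))"
proof -
  \<comment> \<open>A letter \<open>(u, v)\<close> stands for the support entry with
    \<open>w = u + v\<close>, where Strassen's weight is zero; \<open>w < q\<close> cuts the square
    of pairs down to a triangle.\<close>
  define \<Phi> where "\<Phi> = (SIGMA u:{..<q}. {..<q - u})"
  have \<Phi>: "(u, v) \<in> \<Phi> \<longleftrightarrow> u + v < q" for u v by (auto simp: \<Phi>_def)
  have sq: "int a * int b \<le> int q * int q" if "a < q" "b < q" for a b
    using that by (intro mult_mono) auto
  \<comment> \<open>Each product in the expansion of \<open>(u + v - w) ^ 2\<close> is visible on a
    leg: \<open>w ^ 2 - 2 * v * w\<close> where the index is \<open>(v, w)\<close>,
    \<open>- 2 * u * w\<close> where it is \<open>(u, w)\<close>, and \<open>(u + v) ^ 2\<close>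
    where it is \<open>(u, v)\<close>. The bound \<open>2 * q * q\<close> covers the first
    two.\<close>
  have "card \<Phi> ^ m \<le> (2 * m * (2 * q * q) + 1)\<^sup>2 *
      subrank ((q * q) ^ m) ((q * q) ^ m) ((q * q) ^ m)
       (kronecker_power (q * q) (q * q) (q * q) (matmul_tensor q :: 'a tensor3) m)"
  proof (rule subrank_power_degeneration[where x = "\<lambda>(u, v). v * q + (u + v)"
        and y = "\<lambda>(u, v). u * q + (u + v)" and z = "\<lambda>(u, v). u * q + v"
        and \<alpha> = "\<lambda>(u, v). (int (u + v))\<^sup>2 - 2 * int v * int (u + v)"
        and \<beta> = "\<lambda>(u, v). - 2 * int u * int (u + v)" and \<gamma> = "\<lambda>(u, v). (int (u + v))\<^sup>2"])
    show "finite \<Phi>" by (simp add: \<Phi>_def)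
  next
    fix e assume "e \<in> \<Phi>"
    then obtain u v where e: "e = (u, v)" "u + v < q" by (metis \<Phi> surj_pair)
    then show "(case e of (u, v) \<Rightarrow> v * q + (u + v)) < q * q \<and>
      (case e of (u, v) \<Rightarrow> u * q + (u + v)) < q * q \<and> (case e of (u, v) \<Rightarrow> u * q + v) < q * q"
      using pair_index_less[of v q "u + v" q] pair_index_less[of u q "u + v" q] pair_index_less[of u q v q]
      by simp
    show "matmul_tensor q (case e of (u, v) \<Rightarrow> v * q + (u + v)) (case e of (u, v) \<Rightarrow> u * q + (u + v))
        (case e of (u, v) \<Rightarrow> u * q + v) = (1 :: 'a)"
      using e matmul_tensor_entry[of u q u v v "u + v" "u + v"] by simp
    show "(case e of (u, v) \<Rightarrow> (int (u + v))\<^sup>2 - 2 * int v * int (u + v)) +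
        (case e of (u, v) \<Rightarrow> - 2 * int u * int (u + v)) + (case e of (u, v) \<Rightarrow> (int (u + v))\<^sup>2) = 0"
      by (simp add: e power2_eq_square algebra_simps)
    define A V U where "A = int (u + v) * int (u + v)" and "V = int v * int (u + v)"
      and "U = int u * int (u + v)"
    have le: "A \<le> int q * int q" "V \<le> int q * int q" "U \<le> int q * int q"
      unfolding A_def V_def U_def using e by (intro sq; simp)+
    have ge: "0 \<le> A" "0 \<le> V" "0 \<le> U" by (simp_all add: A_def V_def U_def)
    have "(int (u + v))\<^sup>2 - 2 * int v * int (u + v) = A - 2 * V" "- 2 * int u * int (u + v) = - 2 * U"
      "int (2 * q * q) = 2 * (int q * int q)"
      by (simp_all add: A_def V_def U_def power2_eq_square)
    then show "\<bar>case e of (u, v) \<Rightarrow> (int (u + v))\<^sup>2 - 2 * int v * int (u + v)\<bar> \<le> int (2 * q * q) \<and>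
        \<bar>case e of (u, v) \<Rightarrow> - 2 * int u * int (u + v)\<bar> \<le> int (2 * q * q)"
      unfolding e prod.case using le ge by (intro conjI abs_leI) linarith+
  next
    fix e e' e'' assume "e \<in> \<Phi>" "e' \<in> \<Phi>" "e'' \<in> \<Phi>"
    then obtain u v u' v' u'' v'' where e: "e = (u, v)" "u + v < q" "e' = (u', v')" "u' + v' < q"
      "e'' = (u'', v'')" "u'' + v'' < q" by (metis \<Phi> surj_pair)
    assume "matmul_tensor q (case e of (u, v) \<Rightarrow> v * q + (u + v)) (case e' of (u, v) \<Rightarrow> u * q + (u + v))
        (case e'' of (u, v) \<Rightarrow> u * q + v) \<noteq> (0 :: 'a)"
    \<comment> \<open>A nonzero entry makes the two legs that share a variable agree on it, so the
      weight is the square with \<open>u\<close> taken from \<open>e'\<close> and \<open>v\<close>,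
      \<open>w\<close> from \<open>e\<close>.\<close>
    then have eq: "u'' = u'" "v'' = v" "u' + v' = u + v"
      using e matmul_tensor_entry[of u' q u'' v v'' "u + v" "u' + v'", where ?'a = 'a]
      by (auto split: if_splits)
    have weight: "(case e of (u, v) \<Rightarrow> (int (u + v))\<^sup>2 - 2 * int v * int (u + v)) +
        (case e' of (u, v) \<Rightarrow> - 2 * int u * int (u + v)) + (case e'' of (u, v) \<Rightarrow> (int (u + v))\<^sup>2)
        = (int u' + int v - int (u + v))\<^sup>2"
      unfolding e eq(1,2) prod.case eq(3) by (simp add: power2_eq_square algebra_simps)
    show "(case e of (u, v) \<Rightarrow> (int (u + v))\<^sup>2 - 2 * int v * int (u + v)) +
        (case e' of (u, v) \<Rightarrow> - 2 * int u * int (u + v)) + (case e'' of (u, v) \<Rightarrow> (int (u + v))\<^sup>2) \<ge> 0"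
      unfolding weight by simp
    assume "(case e of (u, v) \<Rightarrow> (int (u + v))\<^sup>2 - 2 * int v * int (u + v)) +
        (case e' of (u, v) \<Rightarrow> - 2 * int u * int (u + v)) + (case e'' of (u, v) \<Rightarrow> (int (u + v))\<^sup>2) = 0"
    then have "u' = u" unfolding weight by simp
    then show "e = e' \<and> e' = e''" using e eq by simp
  qed
  moreover have "(q * q) ^ m \<le> (2 * card \<Phi>) ^ m"
    unfolding \<Phi>_def by (intro power_mono two_card_triangle) simp
  ultimately show ?thesis
    by (metis (no_types, lifting) mult_le_mono2 order_trans power_mult_distrib)
qed

section \<open>From the slice rank of a tensor to the subrank of its powers\<close>

lemma slice_rank_restricts_matmul:
  fixes T :: "'a::field tensor3"
  assumes T: "T \<in> tensor_space n1 n2 n3"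
  shows "\<exists>q. slice_rank n1 n2 n3 T \<le> 4 * q \<and>
    restricts_to (n1 ^ 3, n2 ^ 3, n3 ^ 3) (kronecker_power n1 n2 n3 T 3) (q * q, q * q, q * q) (matmul_tensor q)"
proof -
  obtain q1 where q1: "slice_sum n1 n2 n3 T (4 * q1)"
    "restricts_to (n1, n2, n3) T (1, q1, q1) (\<lambda>a b c. of_bool (b = c))"
    using slice_sum_restricts_leg1 by blast
  obtain q2 where q2: "slice_sum n1 n2 n3 T (4 * q2)"
    "restricts_to (n1, n2, n3) T (q2, 1, q2) (\<lambda>a b c. of_bool (a = c))"
    using slice_sum_restricts_leg2 by blast
  obtain q3 where q3: "slice_sum n1 n2 n3 T (4 * q3)"
    "restricts_to (n1, n2, n3) T (q3, q3, 1) (\<lambda>a b c. of_bool (a = b))"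
    using slice_sum_restricts_leg3 by blast
  define q where "q = min q1 (min q2 q3)"
  have "slice_rank n1 n2 n3 T \<le> 4 * q"
    using slice_rank_le_slice_sum[OF T q1(1)] slice_rank_le_slice_sum[OF T q2(1)]
      slice_rank_le_slice_sum[OF T q3(1)] by (simp add: q_def)
  moreover have r: "restricts_to (n1, n2, n3) T (1, q, q) (\<lambda>a b c. of_bool (b = c))"
    "restricts_to (n1, n2, n3) T (q, 1, q) (\<lambda>a b c. of_bool (a = c))"
    "restricts_to (n1, n2, n3) T (q, q, 1) (\<lambda>a b c. of_bool (a = b))"
    using restricts_to_smaller[OF q1(2)] restricts_to_smaller[OF q2(2)] restricts_to_smaller[OF q3(2)]
    by (simp_all add: q_def)
  have "restricts_to (n1 ^ 3, n2 ^ 3, n3 ^ 3) (kronecker_power n1 n2 n3 T 3) (q * q, q * q, q * q) (matmul_tensor q)"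
    using restricts_to_kronecker[OF restricts_to_kronecker[OF restricts_to_kronecker[OF
          restricts_to_refl[of 1 1 1 "unit_tensor 1"] r(1)] r(2)] r(3)]
    by (simp add: matmul_tensor_def numeral_3_eq_3 mult.commute)
  ultimately show ?thesis by blast
qed

lemma subrank_power_ge_slice_rank:
  fixes T :: "'a::field tensor3"
  assumes T: "T \<in> tensor_space n1 n2 n3"
  shows "\<exists>q. slice_rank n1 n2 n3 T \<le> 4 * q \<and> (\<forall>m. (q * q) ^ m \<le> 2 ^ m * ((2 * m * (2 * q * q) + 1)\<^sup>2 *
     subrank (n1 ^ (3 * m)) (n2 ^ (3 * m)) (n3 ^ (3 * m)) (kronecker_power n1 n2 n3 T (3 * m))))"
proof -
  obtain q where q: "slice_rank n1 n2 n3 T \<le> 4 * q"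
    "restricts_to (n1 ^ 3, n2 ^ 3, n3 ^ 3) (kronecker_power n1 n2 n3 T 3) (q * q, q * q, q * q) (matmul_tensor q)"
    using slice_rank_restricts_matmul[OF T] by blast
  have "subrank ((q * q) ^ m) ((q * q) ^ m) ((q * q) ^ m)
       (kronecker_power (q * q) (q * q) (q * q) (matmul_tensor q :: 'a tensor3) m)
      \<le> subrank (n1 ^ (3 * m)) (n2 ^ (3 * m)) (n3 ^ (3 * m)) (kronecker_power n1 n2 n3 T (3 * m))" for m
    using subrank_restricts_mono[OF restricts_to_power[OF q(2), of m]]
    by (simp only: kronecker_power_mult power_mult)
  then have "(q * q) ^ m \<le> 2 ^ m * ((2 * m * (2 * q * q) + 1)\<^sup>2 *
     subrank (n1 ^ (3 * m)) (n2 ^ (3 * m)) (n3 ^ (3 * m)) (kronecker_power n1 n2 n3 T (3 * m)))" for m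
    by (meson subrank_matmul_power mult_le_mono2 order_trans)
  with q(1) show ?thesis by blast
qed

section \<open>Asymptotic subrank and asymptotic slice rank\<close>

text \<open>Fekete's lemma in multiplicative form, the limit being the supremum of the roots. Values
  of at least one ensure that the factor for the remainder \<open>m mod M\<close> does not decrease
  the product.\<close>

lemma supermultiplicative_root_convergent:
  fixes a :: "nat \<Rightarrow> real"
  assumes pos: "\<And>m. 1 \<le> a m" and super: "\<And>m k. a m * a k \<le> a (m + k)"
    and bound: "\<And>m. a m \<le> C ^ m" and C: "0 \<le> C"
  shows "\<exists>L. (\<lambda>m. root m (a m)) \<longlonglongrightarrow> L"
proof -
  let ?x = "\<lambda>m. root m (a m)"
  have x_le: "?x m \<le> C" if "0 < m" for m
  proof -
    have "?x m \<le> root m (C ^ m)" using that bound by simp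
    also have "\<dots> = C" using that C by (simp add: real_root_power_cancel)
    finally show ?thesis .
  qed
  define L where "L = (SUP m\<in>{0<..}. ?x m)"
  have bdd: "bdd_above (?x ` {0<..})" by (rule bdd_aboveI[of _ C]) (use x_le in auto)
  have upper: "?x m \<le> L" if "0 < m" for m
    unfolding L_def by (rule cSUP_upper[OF _ bdd]) (use that in auto)
  have lower: "eventually (\<lambda>m. l < ?x m) sequentially" if l: "l < L" for l
  proof -
    obtain M where M: "0 < M" "l < ?x M"
      using l unfolding L_def by (subst (asm) less_cSUP_iff[OF _ bdd]) auto
    have x1: "1 \<le> ?x M" using M pos[of M] by simp
    have powers: "a M ^ d \<le> a (M * d)" for d
    proof (induction d)
      case (Suc d)
      have "a M ^ Suc d \<le> a M * a (M * d)" using Suc pos[of M] by simp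
      also have "\<dots> \<le> a (M * Suc d)" using super[of M "M * d"] by simp
      finally show ?case .
    qed (use pos in simp)
    \<comment> \<open>Division of \<open>m\<close> by \<open>M\<close> gives
      \<open>a M ^ (m div M) \<le> a m\<close>; the exponent loses less than \<open>M\<close>, which
      is negligible against \<open>m\<close>.\<close>
    have "?x M powr (1 - real M / real m) \<le> ?x m" if m: "0 < m" for m
    proof -
      let ?d = "m div M"
      have "a M ^ ?d \<le> a (M * ?d) * 1" using powers by simp
      also have "\<dots> \<le> a (M * ?d) * a (m mod M)"
        using pos[of "M * ?d"] pos[of "m mod M"] by (intro mult_left_mono) auto
      also have "\<dots> \<le> a m" using super[of "M * ?d" "m mod M"] by simp
      finally have "a M ^ ?d \<le> a m" .
      have "real m - real M \<le> real (M * ?d)"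
      proof -
        have "m mod M < M" using M by simp
        then have "m < M * ?d + M" by (metis add_less_cancel_left mult_div_mod_eq)
        then show ?thesis by linarith
      qed
      then have "?x M powr (real m - real M) \<le> ?x M powr real (M * ?d)"
        using x1 by (intro powr_mono) auto
      also have "\<dots> = (?x M ^ M) ^ ?d" using x1 by (simp add: powr_realpow power_mult[symmetric] del: of_nat_mult)
      also have "\<dots> = a M ^ ?d" using M pos[of M] by simp
      also have "\<dots> \<le> a m" by fact
      finally have "?x M powr (real m - real M) \<le> a m" .
      then have "root m (?x M powr (real m - real M)) \<le> ?x m" using m by simp
      moreover have "root m (?x M powr (real m - real M)) = ?x M powr (1 - real M / real m)"
        using m x1 by (simp add: root_powr_inverse powr_powr field_simps)
      ultimately show ?thesis by simp
    qed
    then have ge: "eventually (\<lambda>m. ?x M powr (1 - real M / real m) \<le> ?x m) sequentially"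
      by (rule eventually_mono[OF eventually_gt_at_top[of 0]])
    have "(\<lambda>m. ?x M powr (1 - real M / real m)) \<longlonglongrightarrow> ?x M powr (1 - 0)"
      using x1 by (intro tendsto_intros tendsto_divide_0[OF tendsto_const] filterlim_at_top_imp_at_infinity
          filterlim_real_sequentially) auto
    then have "(\<lambda>m. ?x M powr (1 - real M / real m)) \<longlonglongrightarrow> ?x M" using x1 by simp
    then have "eventually (\<lambda>m. l < ?x M powr (1 - real M / real m)) sequentially"
      using M(2) by (rule order_tendstoD)
    with ge show ?thesis by eventually_elim simp
  qed
  have "?x \<longlonglongrightarrow> L"
  proof (rule order_tendstoI)
    fix u assume "L < u"
    show "eventually (\<lambda>m. ?x m < u) sequentially"
      using eventually_gt_at_top[of 0]
    proof eventually_elim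
      fix m :: nat assume "0 < m"
      then show "?x m < u" using upper[of m] \<open>L < u\<close> by linarith
    qed
  qed (rule lower)
  then show ?thesis ..
qed

lemma kronecker_power_space:
  assumes "T \<in> tensor_space n1 n2 n3"
  shows "kronecker_power n1 n2 n3 T m \<in> tensor_space (n1 ^ m) (n2 ^ m) (n3 ^ m)"
proof (induction m)
  case 0
  show ?case by (auto simp: tensor_space_def unit_tensor_def)
next
  case (Suc m)
  have div_ge: "a div n < n ^ m \<Longrightarrow> a mod n < n \<Longrightarrow> a < n ^ Suc m" for a n :: nat
    using pair_index_less[of "a div n" "n ^ m" "a mod n" n] by (simp add: mult.commute)
  show ?case
    using assms Suc div_ge unfolding tensor_space_def kronecker_power.simps kronecker_def mem_Collect_eq
    by (metis mult_eq_0_iff)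
qed

text \<open>Under \<open>m\<close>-th roots the polynomial factor tends to one, \<open>2 ^ m\<close>
  becomes 2, and \<open>f (M * (3 * m))\<close> tends to \<open>\<kappa> ^ (3 * M)\<close> as a
  subsequence of the given one. \<open>M\<close> is the power of the tensor to which the bound is
  applied, 3 the number of copies it consumes.\<close>

lemma limit_root_ge_power_bound:
  fixes f :: "nat \<Rightarrow> nat"
  assumes lim: "(\<lambda>m. root m (real (f m))) \<longlonglongrightarrow> \<kappa>" and M: "0 < M" and \<kappa>: "0 \<le> \<kappa>"
    and le: "\<And>m. (q * q) ^ m \<le> 2 ^ m * ((2 * m * (2 * q * q) + 1)\<^sup>2 * f (M * (3 * m)))"
  shows "real (q * q) \<le> 2 * \<kappa> ^ (3 * M)"
proof -
  define B where "B = 2 * real q * real q"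
  have sub: "(\<lambda>m. root (M * (3 * m)) (real (f (M * (3 * m))))) \<longlonglongrightarrow> \<kappa>"
    using M by (intro LIMSEQ_subseq_LIMSEQ[OF lim, unfolded o_def]) (auto simp: strict_mono_def)
  have root_eq: "root (M * (3 * m)) y ^ (3 * M) = root m y" if "0 < m" "0 \<le> y" for m and y :: real
  proof -
    have "root (M * (3 * m)) y = root (3 * M) (root m y)"
      by (metis real_root_mult_exp mult.assoc mult.commute)
    then show ?thesis using M that by simp
  qed
  have "(\<lambda>m. root (M * (3 * m)) (real (f (M * (3 * m)))) ^ (3 * M)) \<longlonglongrightarrow> \<kappa> ^ (3 * M)"
    by (intro tendsto_power sub)
  then have lim': "(\<lambda>m. root m (real (f (M * (3 * m))))) \<longlonglongrightarrow> \<kappa> ^ (3 * M)"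
    by (rule Lim_transform_eventually)
      (use root_eq in \<open>intro eventually_mono[OF eventually_gt_at_top[of 0]]; simp\<close>)
  \<comment> \<open>For \<open>B = 0\<close> the base is constantly one; otherwise \<open>B\<close>
    is positive and the asymptotics are those of a linear base.\<close>
  have "(\<lambda>m. (2 * real m * B + 1) powr (2 / real m)) \<longlonglongrightarrow> 1"
  proof (cases "B = 0")
    case False
    then have "0 < B" by (simp add: B_def)
    then show ?thesis by real_asymp
  qed simp
  then have "(\<lambda>m. 2 * ((2 * real m * B + 1) powr (2 / real m) * root m (real (f (M * (3 * m))))))
      \<longlonglongrightarrow> 2 * (1 * \<kappa> ^ (3 * M))"
    by (intro tendsto_mult lim' tendsto_const)
  moreover have "eventually (\<lambda>m. real (q * q) \<le>
      2 * ((2 * real m * B + 1) powr (2 / real m) * root m (real (f (M * (3 * m)))))) sequentially"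
    using eventually_gt_at_top[of 0]
  proof eventually_elim
    fix m :: nat assume m: "0 < m"
    have B: "0 < 2 * real m * B + 1" by (simp add: B_def add_nonneg_pos)
    have "real ((q * q) ^ m) \<le> real (2 ^ m * ((2 * m * (2 * q * q) + 1)\<^sup>2 * f (M * (3 * m))))"
      using le[of m] by (simp only: of_nat_le_iff)
    then have *: "real (q * q) ^ m \<le> 2 ^ m * ((2 * real m * B + 1)\<^sup>2 * real (f (M * (3 * m))))"
      by (simp add: B_def add.commute)
    have "real (q * q) = root m (real (q * q) ^ m)" using m by (simp add: real_root_power_cancel)
    also have "\<dots> \<le> root m (2 ^ m * ((2 * real m * B + 1)\<^sup>2 * real (f (M * (3 * m)))))"
      using * m by simp
    also have "\<dots> = 2 * (root m ((2 * real m * B + 1)\<^sup>2) * root m (real (f (M * (3 * m)))))"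
      using m by (simp add: real_root_mult real_root_power_cancel)
    also have "root m ((2 * real m * B + 1)\<^sup>2) = (2 * real m * B + 1) powr (2 / real m)"
      using m B by (simp add: root_powr_inverse powr_powr flip: powr_numeral)
    finally show "real (q * q) \<le> 2 * ((2 * real m * B + 1) powr (2 / real m) * root m (real (f (M * (3 * m)))))" .
  qed
  ultimately have "real (q * q) \<le> 2 * (1 * \<kappa> ^ (3 * M))"
    by (rule tendsto_lowerbound) simp
  then show ?thesis by simp
qed

lemma kronecker_power_zero:
  "0 < m \<Longrightarrow> kronecker_power n1 n2 n3 (\<lambda>i j k. 0 :: 'a::field) m = (\<lambda>i j k. 0)"
  by (cases m) (simp_all add: kronecker_def)

lemma slice_rank_zero: "slice_rank n1 n2 n3 (\<lambda>i j k. 0 :: 'a::field) = 0"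
  using slice_rank_le_slice_sum[of "\<lambda>i j k. 0 :: 'a" n1 n2 n3 0]
    slice_sumI[where ?r1.0 = 0 and ?r2.0 = 0 and ?r3.0 = 0 and T = "\<lambda>i j k. 0 :: 'a"]
  by (simp add: tensor_space_def)

text \<open>A nonzero entry, isolated by basis vectors and scaled to one, is a unit tensor of size
  one. This supplies the lower bound that Fekete's lemma asks for.\<close>

lemma subrank_ge_one:
  fixes T :: "'a::field tensor3"
  assumes "T i j k \<noteq> 0" "i < n1" "j < n2" "k < n3"
  shows "1 \<le> subrank n1 n2 n3 T"
proof (rule le_subrank, rule restricts_toI[where X = "\<lambda>_ i'. of_bool (i' = i)"
      and Y = "\<lambda>_ j'. of_bool (j' = j)" and Z = "\<lambda>_ k'. of_bool (k' = k) / T i j k"])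
  fix a b c :: nat assume abc: "a < 1" "b < 1" "c < 1"
  have "(\<Sum>(i', j', k')\<in>box n1 n2 n3. of_bool (i' = i) * of_bool (j' = j) * (of_bool (k' = k) / T i j k) * T i' j' k')
     = (\<Sum>(i', j', k')\<in>box n1 n2 n3. of_bool (i' = i) * of_bool (j' = j) * of_bool (k' = k) * (T i' j' k' / T i j k))"
    by (simp add: field_simps)
  also have "\<dots> = T i j k / T i j k" by (rule sum_box_pick[OF assms(2-4)])
  finally show "unit_tensor 1 a b c =
      (\<Sum>(i', j', k')\<in>box n1 n2 n3. of_bool (i' = i) * of_bool (j' = j) * (of_bool (k' = k) / T i j k) * T i' j' k')"
    using abc assms(1) by (simp add: unit_tensor_def)
qed

lemma limsup_real_bounded:
  fixes x :: "nat \<Rightarrow> real"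
  assumes "\<And>m. 0 \<le> x m" "\<And>m. x m \<le> C"
  shows "\<exists>\<sigma>. limsup (\<lambda>m. ereal (x m)) = ereal \<sigma> \<and> 0 \<le> \<sigma>"
proof -
  have "0 \<le> limsup (\<lambda>m. ereal (x m))"
    by (intro le_Limsup) (use assms in \<open>auto simp: eventually_sequentially\<close>)
  moreover have "limsup (\<lambda>m. ereal (x m)) \<le> ereal C"
    by (intro Limsup_bounded) (use assms in auto)
  ultimately show ?thesis
    by (cases "limsup (\<lambda>m. ereal (x m))") auto
qed

theorem theorem6p10:
  fixes T :: "('a::field) tensor3" and n1 n2 n3 :: nat
  assumes "T \<in> tensor_space n1 n2 n3"
  shows "\<exists>\<sigma> \<kappa> :: real.
    limsup (\<lambda>m. ereal (root m (real (slice_rank (n1 ^ m) (n2 ^ m) (n3 ^ m)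
      (kronecker_power n1 n2 n3 T m))))) = ereal \<sigma> \<and>
    (\<lambda>m. root m (real (subrank (n1 ^ m) (n2 ^ m) (n3 ^ m)
      (kronecker_power n1 n2 n3 T m)))) \<longlonglongrightarrow> \<kappa> \<and>
    \<sigma> \<ge> \<kappa> \<and> \<kappa> \<ge> \<sigma> powr (2 / 3)"
proof -
  define s where "s m = slice_rank (n1 ^ m) (n2 ^ m) (n3 ^ m) (kronecker_power n1 n2 n3 T m)" for m
  define f where "f m = subrank (n1 ^ m) (n2 ^ m) (n3 ^ m) (kronecker_power n1 n2 n3 T m)" for m
  note space = kronecker_power_space[OF assms]
  have f_le_s: "f m \<le> s m" for m
    unfolding f_def s_def by (rule subrank_le_slice_rank[OF space])
  have s_le: "s m \<le> n1 ^ m" for m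
    unfolding s_def by (rule slice_rank_le[OF space])
  \<comment> \<open>\<open>root 0\<close> is constantly zero, so the index \<open>m = 0\<close>
    satisfies the bounds by default.\<close>
  have x_nonneg: "0 \<le> root m (real (s m))" for m by (cases "m = 0") auto
  have "root m (real (s m)) \<le> real n1" for m
  proof (cases "m = 0")
    case False
    have "root m (real (s m)) \<le> root m (real n1 ^ m)"
      using False s_le[of m] by (simp flip: of_nat_power)
    then show ?thesis using False by (simp add: real_root_power_cancel)
  qed simp
  from limsup_real_bounded[of "\<lambda>m. root m (real (s m))", OF x_nonneg this] obtain \<sigma>
    where \<sigma>: "limsup (\<lambda>m. ereal (root m (real (s m)))) = ereal \<sigma>" "0 \<le> \<sigma>" by blast
  have f_super: "f m * f k \<le> f (m + k)" for m k
    unfolding f_def power_add kronecker_power_add by (rule subrank_kronecker)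
  \<comment> \<open>The zero tensor is set apart because its subranks are not at least one; its
    positive powers vanish and the limit is zero.\<close>
  obtain \<kappa> where \<kappa>: "(\<lambda>m. root m (real (f m))) \<longlonglongrightarrow> \<kappa>"
  proof (cases "T = (\<lambda>i j k. 0)")
    case True
    have "f m = 0" if "0 < m" for m
      using f_le_s[of m] that by (simp add: s_def True kronecker_power_zero slice_rank_zero)
    then have "root m (real (f m)) = 0" for m by (cases "m = 0") auto
    then show ?thesis using that[of 0] by simp
  next
    case False
    then obtain i j k where "T i j k \<noteq> 0" by (auto simp: fun_eq_iff)
    moreover then have "i < n1" "j < n2" "k < n3" using assms by (auto simp: tensor_space_def)
    ultimately have "1 \<le> subrank n1 n2 n3 T" by (rule subrank_ge_one)
    then have f_pos: "1 \<le> f m" for m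
    proof (induction m)
      case 0
      show ?case unfolding f_def
        by (rule subrank_ge_one[of _ 0 0 0]) (simp_all add: unit_tensor_def)
    next
      case (Suc m)
      have "f m * subrank n1 n2 n3 T \<le> f (Suc m)"
        unfolding f_def kronecker_power.simps power_Suc2 by (rule subrank_kronecker)
      with Suc show ?case by (metis mult_le_mono mult_1 order_trans)
    qed
    have "\<exists>L. (\<lambda>m. root m (real (f m))) \<longlonglongrightarrow> L"
    proof (rule supermultiplicative_root_convergent[where C = "real n1"])
      show "1 \<le> real (f m)" for m using f_pos[of m] by simp
      show "real (f m) * real (f k) \<le> real (f (m + k))" for m k
        using f_super[of m k] by (metis of_nat_le_iff of_nat_mult)
      show "real (f m) \<le> real n1 ^ m" for m
        using f_le_s[of m] s_le[of m] by (metis of_nat_le_iff of_nat_power order_trans)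
    qed simp
    then show ?thesis using that by blast
  qed
  have \<kappa>0: "0 \<le> \<kappa>"
    by (rule LIMSEQ_le_const[OF \<kappa>]) (auto intro!: exI[of _ 1])
  have "ereal \<kappa> = limsup (\<lambda>m. ereal (root m (real (f m))))"
    using \<kappa> by (intro lim_imp_Limsup[symmetric]) auto
  also have "\<dots> \<le> limsup (\<lambda>m. ereal (root m (real (s m))))"
  proof (intro Limsup_mono always_eventually allI)
    fix m show "ereal (root m (real (f m))) \<le> ereal (root m (real (s m)))"
      using f_le_s[of m] by (cases "m = 0") auto
  qed
  finally have \<kappa>_le: "\<kappa> \<le> \<sigma>" by (simp add: \<sigma>)
  \<comment> \<open>32 is \<open>4 ^ 2 * 2\<close>: the slice rank is at most \<open>4 * q\<close>,
    and \<open>q ^ 2\<close> at most \<open>2 * \<kappa> ^ (3 * M)\<close>.\<close>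
  have s_bound: "real (s M) \<le> sqrt 32 * \<kappa> powr (3 / 2 * M)" if M: "0 < M" for M
  proof -
    obtain q where q: "s M \<le> 4 * q" and le: "\<forall>m. (q * q) ^ m \<le> 2 ^ m * ((2 * m * (2 * q * q) + 1)\<^sup>2 *
       subrank ((n1 ^ M) ^ (3 * m)) ((n2 ^ M) ^ (3 * m)) ((n3 ^ M) ^ (3 * m))
         (kronecker_power (n1 ^ M) (n2 ^ M) (n3 ^ M) (kronecker_power n1 n2 n3 T M) (3 * m)))"
      using subrank_power_ge_slice_rank[OF space[of M]] unfolding s_def by blast
    have "real (q * q) \<le> 2 * \<kappa> ^ (3 * M)"
      by (rule limit_root_ge_power_bound[OF \<kappa> M \<kappa>0])
        (use le in \<open>simp only: f_def kronecker_power_mult power_mult[symmetric]\<close>)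
    moreover have "real (s M) \<le> 4 * real q" using q by linarith
    then have "(real (s M))\<^sup>2 \<le> (4 * real q)\<^sup>2" by (intro power_mono) auto
    ultimately have "(real (s M))\<^sup>2 \<le> 32 * \<kappa> ^ (3 * M)" by (simp add: power2_eq_square)
    then have "real (s M) \<le> sqrt (32 * \<kappa> ^ (3 * M))" by (rule real_le_rsqrt)
    \<comment> \<open>\<open>0 powr x\<close> is zero for every \<open>x\<close>, so at \<kappa> = 0
      it is \<open>M > 0\<close> that makes the ordinary power vanish as well.\<close>
    also have "\<dots> = sqrt 32 * \<kappa> powr (3 / 2 * M)"
    proof (cases "\<kappa> = 0")
      case False
      then have "\<kappa> ^ (3 * M) = (\<kappa> powr (3 / 2 * M))\<^sup>2"
        using \<kappa>0 by (simp add: powr_realpow[symmetric] powr_powr flip: powr_numeral)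
      then show ?thesis by (simp add: real_sqrt_mult)
    qed (use M in simp)
    finally show ?thesis .
  qed
  have "limsup (\<lambda>m. ereal (root m (real (s m)))) \<le> limsup (\<lambda>m. ereal (root m (sqrt 32) * \<kappa> powr (3 / 2)))"
  proof (rule Limsup_mono)
    show "eventually (\<lambda>m. ereal (root m (real (s m))) \<le> ereal (root m (sqrt 32) * \<kappa> powr (3 / 2))) sequentially"
      using eventually_gt_at_top[of 0]
    proof eventually_elim
      fix m :: nat assume m: "0 < m"
      have "\<kappa> powr (3 / 2 * m) = (\<kappa> powr (3 / 2)) ^ m"
      proof (cases "\<kappa> = 0")
        case False
        then have "(\<kappa> powr (3 / 2)) ^ m = (\<kappa> powr (3 / 2)) powr m"
          using \<kappa>0 by (intro powr_realpow[symmetric]) simp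
        then show ?thesis by (simp add: powr_powr)
      qed (use m in simp)
      then have "root m (real (s m)) \<le> root m (sqrt 32 * (\<kappa> powr (3 / 2)) ^ m)"
        using s_bound[OF m] m by simp
      also have "\<dots> = root m (sqrt 32) * root m ((\<kappa> powr (3 / 2)) ^ m)"
        by (rule real_root_mult)
      also have "root m ((\<kappa> powr (3 / 2)) ^ m) = \<kappa> powr (3 / 2)"
        using m by (simp add: real_root_power_cancel)
      finally show "ereal (root m (real (s m))) \<le> ereal (root m (sqrt 32) * \<kappa> powr (3 / 2))" by simp
    qed
  qed
  also have "\<dots> = ereal (1 * \<kappa> powr (3 / 2))"
  proof (rule lim_imp_Limsup)
    have "(\<lambda>m. root m (sqrt 32)) \<longlonglongrightarrow> 1" by (rule LIMSEQ_root_const) simp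
    then show "(\<lambda>m. ereal (root m (sqrt 32) * \<kappa> powr (3 / 2))) \<longlonglongrightarrow> ereal (1 * \<kappa> powr (3 / 2))"
      by (intro tendsto_intros)
  qed simp
  finally have "\<sigma> \<le> \<kappa> powr (3 / 2)" by (simp add: \<sigma>)
  then have "\<sigma> powr (2 / 3) \<le> (\<kappa> powr (3 / 2)) powr (2 / 3)"
    using \<sigma>(2) by (intro powr_mono2) auto
  also have "\<dots> = \<kappa>" using \<kappa>0 by (simp add: powr_powr)
  finally have "\<sigma> powr (2 / 3) \<le> \<kappa>" .
  with \<sigma>(1) \<kappa> \<kappa>_le show ?thesis unfolding s_def f_def by blast
qed

end
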